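(* There is an absolute constant $c>0$ such that for every integer $n\ge 1$ and every choice of coefficients $a_R\in\{\pm 1\}$, indexed by the dyadic rectangles $R=R_1\times R_2\times R_3\subset[0,1]^3$ with $\lvert R\rvert=2^{-n}$ and $\lvert R_1\rvert\ge 2^{-n/2}$, we have $$ \Bigl\lVert \sum_{\substack{R\subset[0,1]^3 \text{ dyadic},\ \lvert R\rvert=2^{-n}\\ \lvert R_1\rvert\ge 2^{-n/2}}} a_R\, h_R \Bigr\rVert_{L^\infty([0,1]^3)} \ \ge\ c\, n^{9/8}. $$
   Context: The dyadic intervals are $\mathcal D=\{[j2^k,(j+1)2^k) : j,k\in\mathbb Z\}$. Each dyadic interval $I$ is the union of its left half $I_{\mathrm{left}}$ and right half $I_{\mathrm{right}}$, and its ($L^\infty$-normalized) Haar function is $h_I=-\mathbf 1_{I_{\mathrm{left}}}+\mathbf 1_{I_{\mathrm{right}}}$. A dyadic rectangle in dimension 3 is $R=R_1\times R_2\times R_3$ with $R_1,R_2,R_3\in\mathcal D$; its Haar function is $h_R(x_1,x_2,x_3)=h_{R_1}(x_1)h_{R_2}(x_2)h_{R_3}(x_3)$. $\lvert\cdot\rvert$ applied to an interval or a rectangle denotes its length or its volume (Lebesgue measure). *)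

theory Defs
  imports "HOL-Analysis.Analysis" "HOL-Probability.Essential_Supremum"
begin

definition dyadic_intervals :: "real set set" where
  "dyadic_intervals = {{of_int j * 2 powi k ..< (of_int j + 1) * 2 powi k} | j k :: int. True}"

text \<open>Midpoint and halves are meant for half-open intervals \<open>I = {a..<b}\<close> with \<open>a < b\<close>, for which
  \<open>Inf I = a\<close> and \<open>Sup I = b\<close>.\<close>

definition midpt :: "real set \<Rightarrow> real" where
  "midpt I = (Inf I + Sup I) / 2"

definition left_half :: "real set \<Rightarrow> real set" where
  "left_half I = {x \<in> I. x < midpt I}"

definition right_half :: "real set \<Rightarrow> real set" where
  "right_half I = {x \<in> I. midpt I \<le> x}"

definition haar :: "real set \<Rightarrow> real \<Rightarrow> real" where
  "haar I x = - indicator (left_half I) x + indicator (right_half I) x"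

lemma haar_atLeastLessThan:
  assumes "a < b"
  shows "haar {a..<b} x = - indicator {a..<(a + b) / 2} x + indicator {(a + b) / 2..<b} x"
  using assms by (auto simp: haar_def left_half_def right_half_def midpt_def indicator_def)

text \<open>A dyadic rectangle is represented by its triple of sides \<open>(R\<^sub>1, R\<^sub>2, R\<^sub>3)\<close>; as the sides are nonempty,
  the triple is determined by the point set \<open>box_of (R\<^sub>1, R\<^sub>2, R\<^sub>3)\<close>.\<close>

type_synonym rect3 = "real set \<times> real set \<times> real set"

definition box_of :: "rect3 \<Rightarrow> (real \<times> real \<times> real) set" where
  "box_of = (\<lambda>(R1, R2, R3). R1 \<times> R2 \<times> R3)"

definition dyadic_rectangles :: "rect3 set" where
  "dyadic_rectangles = dyadic_intervals \<times> dyadic_intervals \<times> dyadic_intervals"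

definition haar3 :: "rect3 \<Rightarrow> real \<times> real \<times> real \<Rightarrow> real" where
  "haar3 = (\<lambda>(R1, R2, R3) (x1, x2, x3). haar R1 x1 * haar R2 x2 * haar R3 x3)"

definition unit_cube :: "(real \<times> real \<times> real) set" where
  "unit_cube = {0..1} \<times> {0..1} \<times> {0..1}"

definition admissible_rectangles :: "nat \<Rightarrow> rect3 set" where
  "admissible_rectangles n =
     {R \<in> dyadic_rectangles. box_of R \<subseteq> unit_cube \<and>
        measure lborel (box_of R) = 2 powr (- real n) \<and>
        measure lborel (fst R) \<ge> 2 powr (- real n / 2)}"

definition Linf_norm_on :: "'a::euclidean_space set \<Rightarrow> ('a \<Rightarrow> real) \<Rightarrow> ereal" where
  "Linf_norm_on S f = esssup (lebesgue_on S) (\<lambda>x. ereal \<bar>f x\<bar>)"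

text \<open>The following facts exclude the degenerate values of the library notions used: \<open>sum\<close> is 0 over
  an infinite set, and \<open>esssup\<close> is \<open>\<infinity>\<close> for a non-measurable function.\<close>

lemma measure_side_ge:
  fixes u v w :: real
  assumes "0 < u" "u \<le> 1" "0 < v" "v \<le> 1" "0 < w" "w \<le> 1" "u * (v * w) = m"
  shows "m \<le> u" "m \<le> v" "m \<le> w"
proof -
  have "v * w \<le> 1" "u * v \<le> 1" "u * w \<le> 1"
    using assms by (auto intro!: mult_le_one)
  then show "m \<le> u" "m \<le> v" "m \<le> w"
    using assms mult_left_mono[of "v * w" 1 u] mult_left_mono[of "u * w" 1 v]
      mult_left_mono[of "u * v" 1 w] by (auto simp: mult_ac)
qed

lemma finite_dyadic_intervals:
  "finite {I \<in> dyadic_intervals. I \<subseteq> {0..1} \<and> measure lborel I \<ge> 2 powr (- real n)}" (is "finite ?A")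
proof -
  define g :: "int \<times> int \<Rightarrow> real set"
    where "g = (\<lambda>(j, k). {of_int j * 2 powi k ..< (of_int j + 1) * 2 powi k})"
  have "?A \<subseteq> g ` ({0..2 ^ n} \<times> {- int n..0})"
  proof
    fix I assume "I \<in> ?A"
    then obtain j k :: int where I: "I = {of_int j * 2 powi k ..< (of_int j + 1) * 2 powi k}"
      and sub: "I \<subseteq> {0..1}" and m: "measure lborel I \<ge> 2 powr (- real n)"
      unfolding dyadic_intervals_def by blast
    define p :: real where "p = 2 powi k"
    have p: "p > 0" by (simp add: p_def)
    have pk: "p = 2 powr k" by (simp add: p_def powr_real_of_int')
    have I': "I = {j * p ..< (j + 1) * p}" by (simp add: I p_def)
    have lt: "j * p < (j + 1) * p" using p by (simp add: algebra_simps)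
    then have "j * p \<in> I" by (simp add: I')
    then have j0: "0 \<le> j * p" using sub by auto
    have "{j * p <..< (j + 1) * p} \<subseteq> {0..1}" using sub by (auto simp: I')
    then have up: "(j + 1) * p \<le> 1"
      using lt by (simp add: greaterThanLessThan_subseteq_atLeastAtMost_iff)
    have "measure lborel I = p"
      using lt by (simp add: I' algebra_simps)
    then have "2 powr (- real n) \<le> 2 powr k" using m pk by simp
    then have k1: "- int n \<le> k" by simp
    have "p \<le> 1" using j0 up by (simp add: algebra_simps)
    then have "2 powr k \<le> 2 powr (0::real)" using pk by simp
    then have k0: "k \<le> 0" by (subst (asm) powr_le_cancel_iff) auto
    have j1: "0 \<le> j" using j0 p by (simp add: zero_le_mult_iff)
    have "j * 2 powr (- real n) \<le> j * p"
      using \<open>2 powr (- real n) \<le> 2 powr k\<close> pk j1 by (intro mult_left_mono) auto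
    also have "\<dots> \<le> 1" using up lt by simp
    finally have "real_of_int j \<le> 2 ^ n" by (simp add: powr_minus powr_realpow field_simps)
    then have "j \<le> 2 ^ n" by (metis of_int_le_iff of_int_numeral of_int_power)
    with j1 k0 k1 show "I \<in> g ` ({0..2 ^ n} \<times> {- int n..0})"
      by (auto simp: g_def I intro!: image_eqI[of _ _ "(j, k)"])
  qed
  then show ?thesis by (rule finite_subset) auto
qed

lemma dyadic_interval_cases:
  assumes "I \<in> dyadic_intervals"
  obtains a b where "a < b" "I = {a..<b}"
proof -
  obtain j k :: int where "I = {of_int j * 2 powi k ..< (of_int j + 1) * 2 powi k}"
    using assms unfolding dyadic_intervals_def by blast
  moreover have "real_of_int j * 2 powi k < (of_int j + 1) * 2 powi k"
    by (simp add: mult_less_cancel_right not_le)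
  ultimately show thesis using that by blast
qed

lemma measure_box_of:
  assumes "(R1, R2, R3) \<in> dyadic_rectangles"
  shows "measure lborel (box_of (R1, R2, R3)) = measure lborel R1 * (measure lborel R2 * measure lborel R3)"
proof -
  from assms have "R1 \<in> sets lborel" "R2 \<in> sets lborel" "R3 \<in> sets lborel"
    unfolding dyadic_rectangles_def by (auto elim!: dyadic_interval_cases)
  then show ?thesis
    by (simp add: box_of_def measure_def lborel_prod[symmetric] lborel.emeasure_pair_measure_Times
        lborel_pair.emeasure_pair_measure_Times enn2real_mult)
qed

lemma finite_admissible_rectangles: "finite (admissible_rectangles n)"
proof -
  define A where "A = {I \<in> dyadic_intervals. I \<subseteq> {0..1} \<and> measure lborel I \<ge> 2 powr (- real n)}"
  have le1: "0 < measure lborel I \<and> measure lborel I \<le> 1"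
    if I: "I \<in> dyadic_intervals" and sub: "I \<subseteq> {0..1}" for I
  proof -
    obtain a b where ab: "a < b" "I = {a..<b}" using I by (rule dyadic_interval_cases)
    then have "{a<..<b} \<subseteq> {0..1}" using sub by auto
    then have "0 \<le> a" "b \<le> 1" using ab by (auto simp: greaterThanLessThan_subseteq_atLeastAtMost_iff)
    with ab show ?thesis by simp
  qed
  have "admissible_rectangles n \<subseteq> A \<times> A \<times> A"
  proof
    fix R assume R: "R \<in> admissible_rectangles n"
    obtain R1 R2 R3 where R3: "R = (R1, R2, R3)" by (cases R)
    have d: "R1 \<in> dyadic_intervals" "R2 \<in> dyadic_intervals" "R3 \<in> dyadic_intervals"
      using R by (auto simp: R3 admissible_rectangles_def dyadic_rectangles_def)
    have "R1 \<noteq> {}" "R2 \<noteq> {}" "R3 \<noteq> {}" using d by (auto elim!: dyadic_interval_cases)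
    then have s: "R1 \<subseteq> {0..1}" "R2 \<subseteq> {0..1}" "R3 \<subseteq> {0..1}"
      using R by (auto simp: R3 admissible_rectangles_def box_of_def unit_cube_def times_subset_iff)
    have "measure lborel R1 * (measure lborel R2 * measure lborel R3) = 2 powr (- real n)"
      using R measure_box_of[of R1 R2 R3] by (auto simp: R3 admissible_rectangles_def)
    from measure_side_ge[OF _ _ _ _ _ _ this] le1 d s
    show "R \<in> A \<times> A \<times> A" by (auto simp: R3 A_def)
  qed
  then show ?thesis
    by (rule finite_subset) (use finite_dyadic_intervals[of n] in \<open>auto simp: A_def\<close>)
qed

lemma haar_measurable [measurable]:
  assumes "I \<in> dyadic_intervals"
  shows "haar I \<in> borel_measurable borel"
proof -
  obtain a b where "a < b" "I = {a..<b}" using assms by (rule dyadic_interval_cases)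
  then have "haar I = (\<lambda>x. - indicator {a..<(a + b) / 2} x + indicator {(a + b) / 2..<b} x)"
    by (auto simp: haar_atLeastLessThan)
  then show ?thesis by simp
qed

lemma haar3_measurable [measurable]:
  assumes "R \<in> dyadic_rectangles"
  shows "haar3 R \<in> borel_measurable borel"
proof -
  obtain R1 R2 R3 where R: "R = (R1, R2, R3)" by (cases R)
  have [measurable]: "haar R1 \<in> borel_measurable borel" "haar R2 \<in> borel_measurable borel"
    "haar R3 \<in> borel_measurable borel"
    using assms by (auto simp: R dyadic_rectangles_def intro: haar_measurable)
  have "(\<lambda>x. haar R1 (fst x) * haar R2 (fst (snd x)) * haar R3 (snd (snd x)))
    \<in> borel_measurable (borel \<Otimes>\<^sub>M (borel \<Otimes>\<^sub>M borel))"
    by measurable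
  then show ?thesis by (simp add: R haar3_def case_prod_unfold borel_prod)
qed

lemma haar_sum_measurable:
  "(\<lambda>x. ereal \<bar>\<Sum>R\<in>admissible_rectangles n. a R * haar3 R x\<bar>)
     \<in> borel_measurable (lebesgue_on unit_cube)"
proof -
  have "(\<lambda>x. ereal \<bar>\<Sum>R\<in>admissible_rectangles n. a R * haar3 R x\<bar>) \<in> borel_measurable borel"
    by (intro borel_measurable_ereal borel_measurable_abs borel_measurable_sum borel_measurable_times
        borel_measurable_const haar3_measurable) (auto simp: admissible_rectangles_def)
  then show ?thesis
    by (intro measurable_restrict_space1 measurable_completion) simp
qed

end

theory Submission
  imports Defs "HOL-Probability.Hoeffding"
begin

text \<open>Write the binary digits of the three coordinates as signs and group the sum by the scale \<open>k\<close> of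
  the first side, \<open>F = \<Sum>\<^sub>k r\<^sub>k(x\<^sub>1) g\<^sub>k\<close>, where \<open>g\<^sub>k\<close> is a sum of \<open>n - k + 1\<close> signs in \<open>(x\<^sub>2, x\<^sub>3)\<close> that
  depends on \<open>x\<^sub>1\<close> only through its first \<open>k\<close> digits. Averaging over the digits of \<open>x\<^sub>1\<close> one at a time,
  \<open>E (exp (\<epsilon> F) / \<Prod>\<^sub>k cosh (\<epsilon> g\<^sub>k)) = 1\<close>, so \<open>F \<le> B\<close> everywhere forces
  \<open>1 \<le> exp (\<epsilon> B) E (\<Prod>\<^sub>k 1 / cosh (\<epsilon> g\<^sub>k))\<close>. With \<open>\<epsilon> = n powr (-7/8)\<close> it suffices to bound the last
  expectation by \<open>exp (- c n powr (1/4))\<close>, i.e. to show that for fixed \<open>x\<^sub>1\<close> it is very unlikely in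
  \<open>(x\<^sub>2, x\<^sub>3)\<close> that most \<open>g\<^sub>k\<close> are much smaller than \<open>sqrt n\<close>.

  For this, \<open>1 / cosh\<close> is replaced by the exponential of a multiple of \<open>cos (a g\<^sub>k) - 1\<close> with \<open>a\<close> of order
  \<open>1 / sqrt n\<close>. After the normalisation by powers of \<open>cos a\<close>, the sum \<open>\<Sum>\<^sub>k cos (a g\<^sub>k)\<close> is a martingale in the
  digits of \<open>x\<^sub>2\<close> with small mean. Its quadratic variation is a sum over pairs \<open>k, k'\<close>, and the
  off-diagonal terms are in turn sub-Gaussian at scale \<open>sqrt n\<close> in the digits of \<open>x\<^sub>3\<close>, because the
  products of the corresponding signs for different scales \<open>j\<close> are nearly orthogonal.\<close>

subsection \<open>Averages over digit strings\<close>

definition sg :: "bool \<Rightarrow> real" where "sg b = (if b then 1 else -1)"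

lemma sg_simps [simp]: "sg True = 1" "sg False = -1" "\<bar>sg b\<bar> = 1" "sg b * sg b = 1"
  by (auto simp: sg_def)

definition avg :: "nat \<Rightarrow> (bool list \<Rightarrow> real) \<Rightarrow> real" where
  "avg N \<phi> = (\<Sum>xs | length xs = N. \<phi> xs) / 2 ^ N"

lemma finite_bool_lists [simp]: "finite {xs :: bool list. length xs = N}"
  using finite_lists_length_eq[of "UNIV :: bool set" N] by simp

lemma card_bool_lists: "card {xs :: bool list. length xs = N} = 2 ^ N"
  using card_lists_length_eq[of "UNIV :: bool set" N] by simp

lemma avg_0 [simp]: "avg 0 \<phi> = \<phi> []"
  by (simp add: avg_def)

text \<open>Conditioning on all but the last digit. This is the tower property behind every
  digit-by-digit induction below.\<close>

lemma avg_Suc: "avg (Suc N) \<phi> = avg N (\<lambda>xs. (\<phi> (xs @ [True]) + \<phi> (xs @ [False])) / 2)"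
proof -
  let ?L = "{xs :: bool list. length xs = N}"
  have eq: "{xs :: bool list. length xs = Suc N} = (\<lambda>(xs, b). xs @ [b]) ` (?L \<times> UNIV)"
    by (auto simp: image_iff length_Suc_conv_rev)
  have "(\<Sum>xs | length xs = Suc N. \<phi> xs) = (\<Sum>(xs, b) \<in> ?L \<times> UNIV. \<phi> (xs @ [b]))"
    unfolding eq by (subst sum.reindex) (auto simp: inj_on_def case_prod_unfold)
  also have "\<dots> = (\<Sum>xs\<in>?L. \<phi> (xs @ [True]) + \<phi> (xs @ [False]))"
    by (simp add: sum.cartesian_product[symmetric] UNIV_bool add.commute)
  finally show ?thesis
    by (simp add: avg_def sum_divide_distrib[symmetric])
qed

lemma avg_cong: "(\<And>xs. length xs = N \<Longrightarrow> \<phi> xs = \<psi> xs) \<Longrightarrow> avg N \<phi> = avg N \<psi>"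
  by (simp add: avg_def)

lemma avg_mono: "(\<And>xs. length xs = N \<Longrightarrow> \<phi> xs \<le> \<psi> xs) \<Longrightarrow> avg N \<phi> \<le> avg N \<psi>"
  by (auto simp: avg_def intro!: divide_right_mono sum_mono)

lemma avg_const [simp]: "avg N (\<lambda>_. c) = c"
  by (simp add: avg_def card_bool_lists)

lemma avg_cmult: "avg N (\<lambda>xs. c * \<phi> xs) = c * avg N \<phi>"
  by (simp add: avg_def sum_distrib_left)

lemma avg_add: "avg N (\<lambda>xs. \<phi> xs + \<psi> xs) = avg N \<phi> + avg N \<psi>"
  by (simp add: avg_def sum.distrib add_divide_distrib)

lemma avg_sum: "avg N (\<lambda>xs. \<Sum>i\<in>I. \<phi> i xs) = (\<Sum>i\<in>I. avg N (\<phi> i))"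
  unfolding avg_def by (subst sum.swap) (simp add: sum_divide_distrib)

lemma avg_swap: "avg N (\<lambda>xs. avg M (\<phi> xs)) = avg M (\<lambda>ys. avg N (\<lambda>xs. \<phi> xs ys))"
  unfolding avg_def sum_divide_distrib[symmetric]
  by (subst sum.swap) (simp add: mult.commute)

lemma avg_take: "N \<le> M \<Longrightarrow> avg M (\<lambda>xs. \<phi> (take N xs)) = avg N \<phi>"
proof (induction M rule: dec_induct)
  case base
  show ?case by (rule avg_cong) simp
next
  case (step M)
  have "avg (Suc M) (\<lambda>xs. \<phi> (take N xs)) = avg M (\<lambda>xs. \<phi> (take N xs))"
    unfolding avg_Suc using step.hyps by (intro avg_cong) simp
  with step.IH show ?case by simp
qed

text \<open>The amplitude \<open>g (take k xs)\<close> is fixed before digit \<open>k\<close> is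
  drawn, so averaging over that digit turns its exponential factor into a \<open>cosh\<close>, which
  the matching denominator cancels: a positive martingale of mean 1.\<close>

lemma avg_exp_div_cosh:
  "avg N (\<lambda>xs. exp (\<Sum>k<N. e * (sg (xs ! k) * g (take k xs)))
      * (\<Prod>k<N. 1 / cosh (e * g (take k xs)))) = 1"
proof (induction N)
  case (Suc N)
  have "(exp (x + u) * (y / cosh u) + exp (x - u) * (y / cosh u)) / 2 = exp x * y" for x y u :: real
  proof -
    have "exp (x + u) + exp (x - u) = 2 * (exp x * cosh u)"
      by (simp add: cosh_def exp_add exp_diff exp_minus field_simps)
    then have "(exp (x + u) + exp (x - u)) * (y / cosh u) / 2 = exp x * y"
      using cosh_real_pos[of u] by (simp add: field_simps)
    then show ?thesis using cosh_real_pos[of u] by (simp add: field_simps)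
  qed
  then have "avg (Suc N) (\<lambda>xs. exp (\<Sum>k<Suc N. e * (sg (xs ! k) * g (take k xs)))
      * (\<Prod>k<Suc N. 1 / cosh (e * g (take k xs))))
    = avg N (\<lambda>xs. exp (\<Sum>k<N. e * (sg (xs ! k) * g (take k xs)))
      * (\<Prod>k<N. 1 / cosh (e * g (take k xs))))"
    unfolding avg_Suc by (intro avg_cong) (simp add: nth_append)
  with Suc show ?case by simp
qed simp

subsection \<open>Exponential inequalities\<close>

text \<open>For \<open>v \<ge> 0\<close> this is the scalar inequality behind Hoeffding's lemma at
  \<open>p = 1 / 2\<close>, where \<open>1 + p * (exp (2 * v) - 1) = exp v * cosh v\<close>.
  Evenness gives the rest.\<close>

lemma cosh_le_exp_half_square: "cosh (u::real) \<le> exp (u\<^sup>2 / 2)"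
proof -
  have *: "cosh v \<le> exp (v\<^sup>2 / 2)" if "0 \<le> v" for v :: real
  proof -
    have "1 + 1 / 2 * (exp (2 * v) - 1) = exp v * cosh v"
      by (simp add: cosh_def exp_minus field_simps flip: exp_add)
    moreover have "ln (exp v * cosh v) = v + ln (cosh v)"
      using cosh_real_pos[of v] by (simp add: ln_mult)
    ultimately have "ln (cosh v) \<le> v\<^sup>2 / 2"
      using Hoeffdings_lemma_aux[of "2 * v" "1 / 2"] that by simp
    then show ?thesis
      using cosh_real_pos[of v] by (metis exp_le_cancel_iff exp_ln)
  qed
  show ?thesis using *[of u] *[of "- u"] by (cases "0 \<le> u") auto
qed

text \<open>Exponential supermartingale: the random sign contributes a factor
  \<open>cosh (Q us)\<close> on average, and the compensator
  \<open>exp (- (Q us)\<^sup>2 / 2)\<close> absorbs it because \<open>Q us\<close> is known before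
  the digit \<open>b\<close>.\<close>

lemma avg_exp_compensated_le:
  assumes "\<And>us b. P (us @ [b]) = P us + sg b * Q us"
  shows "avg N (\<lambda>ys. exp (P ys - (\<Sum>j<N. (Q (take j ys))\<^sup>2) / 2)) \<le> exp (P [])"
proof (induction N)
  case (Suc N)
  have *: "(exp (x + u - (s + u\<^sup>2) / 2) + exp (x - u - (s + u\<^sup>2) / 2)) / 2 \<le> exp (x - s / 2)" for x u s :: real
  proof -
    have "(exp (x + u - (s + u\<^sup>2) / 2) + exp (x - u - (s + u\<^sup>2) / 2)) / 2 = exp (x - s / 2) * (cosh u / exp (u\<^sup>2 / 2))"
    proof -
      have "exp (x + v - (s + u\<^sup>2) / 2) = exp (x - s / 2) / exp (u\<^sup>2 / 2) * exp v" for v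
        by (simp add: add_divide_distrib flip: exp_add exp_diff)
      from this[of u] this[of "- u"] show ?thesis
        by (simp add: cosh_def distrib_left add_divide_distrib)
    qed
    also have "\<dots> \<le> exp (x - s / 2) * 1"
      using cosh_le_exp_half_square[of u] by (intro mult_left_mono) auto
    finally show ?thesis by simp
  qed
  have "avg (Suc N) (\<lambda>ys. exp (P ys - (\<Sum>j<Suc N. (Q (take j ys))\<^sup>2) / 2))
      \<le> avg N (\<lambda>ys. exp (P ys - (\<Sum>j<N. (Q (take j ys))\<^sup>2) / 2))"
    unfolding avg_Suc
  proof (rule avg_mono)
    fix us :: "bool list" assume us: "length us = N"
    have "(\<Sum>j<Suc N. (Q (take j (us @ [b])))\<^sup>2) = (\<Sum>j<N. (Q (take j us))\<^sup>2) + (Q us)\<^sup>2" for b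
      using us by simp
    with *[of "P us" "Q us" "\<Sum>j<N. (Q (take j us))\<^sup>2"]
    show "(exp (P (us @ [True]) - (\<Sum>j<Suc N. (Q (take j (us @ [True])))\<^sup>2) / 2)
        + exp (P (us @ [False]) - (\<Sum>j<Suc N. (Q (take j (us @ [False])))\<^sup>2) / 2)) / 2
      \<le> exp (P us - (\<Sum>j<N. (Q (take j us))\<^sup>2) / 2)"
      by (simp only: assms sg_simps mult_1_left mult_minus_left add_uminus_conv_diff)
  qed
  with Suc show ?case by linarith
qed simp

lemma one_minus_cos_le: "1 - cos (x::real) \<le> x\<^sup>2 / 2"
proof -
  have "1 - cos x = 2 * (sin (x / 2))\<^sup>2"
    using cos_double_sin[of "x / 2"] by simp
  also have "\<dots> \<le> 2 * (x / 2)\<^sup>2"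
    using abs_sin_x_le_abs_x[of "x / 2"] by (intro mult_left_mono) (simp_all only: abs_le_square_iff)
  finally show ?thesis by (simp add: power_divide)
qed

lemma cosh_ge_quadratic: "1 + (u::real)\<^sup>2 / 4 \<le> cosh u"
proof -
  have *: "1 + v\<^sup>2 / 4 \<le> cosh v" if "0 \<le> v" for v :: real
    using exp_lower_Taylor_quadratic[OF that] exp_ge_add_one_self[of "- v"]
    by (simp add: cosh_def field_simps)
  show ?thesis using *[of u] *[of "- u"] by (cases "0 \<le> u") auto
qed

text \<open>The cosine on the right is what makes a martingale argument possible later. For
  \<open>u\<^sup>2 / 4 \<le> 1\<close> quadratic bounds for both sides suffice; for larger
  \<open>u\<close> the exponent stays at most \<open>1 / 2\<close> in absolute value while
  \<open>cosh u \<ge> 2\<close>.\<close>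

lemma inverse_cosh_le:
  fixes u \<tau> :: real
  assumes "0 < \<tau>" "\<tau> \<le> 1 / 2"
  shows "1 / cosh u \<le> exp (- (\<tau>\<^sup>2 / 4 * (1 - cos (u / \<tau>))))"
proof -
  define w where "w = \<tau>\<^sup>2 / 4 * (1 - cos (u / \<tau>))"
  define v where "v = u\<^sup>2 / 4"
  have exp_half: "exp (x / 2) \<le> 1 + x" if "0 \<le> x" "x \<le> 1" for x :: real
  proof -
    have "exp (x / 2) \<le> 1 + x / 2 + (x / 2)\<^sup>2" using that by (intro exp_bound) auto
    also have "(x / 2)\<^sup>2 \<le> x / 2"
      using that mult_left_mono[of x 1 x] by (simp add: power2_eq_square)
    finally show ?thesis by simp
  qed
  have "exp w \<le> 1 + v"
  proof (cases "v \<le> 1")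
    case True
    have "w \<le> \<tau>\<^sup>2 / 4 * ((u / \<tau>)\<^sup>2 / 2)"
      unfolding w_def by (intro mult_left_mono one_minus_cos_le) auto
    also have "\<dots> = v / 2" using assms by (simp add: v_def field_simps)
    finally have "exp w \<le> exp (v / 2)" by simp
    also have "\<dots> \<le> 1 + v" using True by (intro exp_half) (auto simp: v_def)
    finally show ?thesis .
  next
    case False
    have "w \<le> \<tau>\<^sup>2 / 4 * 2"
      unfolding w_def using cos_ge_minus_one[of "u / \<tau>"] by (intro mult_left_mono) auto
    also have "\<dots> \<le> 1 / 2"
      using assms power_mono[of \<tau> "1 / 2" 2] by (simp add: power2_eq_square)
    finally have "exp w \<le> exp (1 / 2)" by simp
    also have "\<dots> \<le> 1 + 1" using exp_half[of 1] by simp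
    finally show ?thesis using False by simp
  qed
  also have "\<dots> \<le> cosh u" unfolding v_def by (rule cosh_ge_quadratic)
  finally have "1 / cosh u \<le> 1 / exp w"
    by (intro divide_left_mono) auto
  then show ?thesis by (simp add: w_def exp_minus inverse_eq_divide)
qed

text \<open>Fourth-order Taylor expansion, the quartic remainder being absorbed by half of the
  quadratic term. It shows that powers of \<open>cos a\<close> of order \<open>1 / a\<^sup>2\<close>
  are bounded away from 1.\<close>

lemma cos_le_exp:
  fixes a :: real
  assumes "\<bar>a\<bar> \<le> 1"
  shows "cos a \<le> exp (- (a\<^sup>2 / 4))"
proof -
  obtain t where t: "cos a = (\<Sum>m<4. cos_coeff m * a ^ m) + cos (t + 1/2 * real 4 * pi) / fact 4 * a ^ 4"
    using Maclaurin_cos_expansion[of a 4] by blast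
  have "cos (t + 1/2 * real 4 * pi) / fact 4 * a ^ 4 \<le> 1 / fact 4 * a ^ 4"
    by (intro mult_right_mono divide_right_mono cos_le_one) auto
  also have "\<dots> \<le> a\<^sup>2 / 4"
  proof -
    have "a\<^sup>2 \<le> 1" using assms by (simp add: abs_square_le_1)
    then have "a\<^sup>2 * a\<^sup>2 \<le> a\<^sup>2 * 1" by (intro mult_left_mono) auto
    then have "a ^ 4 \<le> a\<^sup>2" by (simp add: power2_eq_square power4_eq_xxxx mult.assoc)
    moreover have "fact 4 = (24 :: real)" by (simp add: fact_numeral)
    ultimately show ?thesis using zero_le_power2[of a] by (simp only:)
  qed
  moreover have "(\<Sum>m<4. cos_coeff m * a ^ m) = 1 - a\<^sup>2 / 2"
  proof -
    have "{..<4::nat} = {0, 1, 2, 3}" by auto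
    then show ?thesis by (simp add: cos_coeff_def)
  qed
  ultimately have "cos a \<le> 1 + - (a\<^sup>2 / 4)"
    using t by linarith
  also have "\<dots> \<le> exp (- (a\<^sup>2 / 4))" by (rule exp_ge_add_one_self)
  finally show ?thesis .
qed

text \<open>Jensen's inequality for the uniform measure on \<open>I\<close>. It serves for the
  average over pairs of scales and, with \<open>I\<close> the two booleans, for splitting an
  exponent into two halves.\<close>

lemma exp_mean_le:
  assumes "finite I" "I \<noteq> {}"
  shows "exp ((\<Sum>i\<in>I. x i) / card I) \<le> (\<Sum>i\<in>I. exp (x i)) / card I"
proof -
  have "convex_on UNIV (exp :: real \<Rightarrow> real)" using convex_on_exp[of 1] by simp
  with assms have "exp (\<Sum>i\<in>I. (1 / real (card I)) *\<^sub>R x i) \<le> (\<Sum>i\<in>I. (1 / real (card I)) * exp (x i))"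
    by (intro convex_on_sum[where C = UNIV and a = "\<lambda>_. 1 / real (card I)"]) simp_all
  then show ?thesis
    unfolding real_scaleR_def sum_distrib_left[symmetric] by simp
qed

text \<open>The digit \<open>b\<close> both creates the new summand and rotates the old sum \<open>z\<close>; since the
  rotation angle \<open>a\<close> is small, the two are nearly uncorrelated.\<close>

lemma exp_norm_square_step:
  fixes z :: complex and \<theta> :: real
  assumes v: "0 \<le> v" "v \<le> 1" and \<sigma>: "\<bar>\<sigma>\<bar> = 1" and \<beta>: "\<bar>\<beta>\<bar> = 1"
    and \<mu>: "0 \<le> \<mu>" "\<mu> \<le> a\<^sup>2 / 2"
  defines "W \<equiv> \<lambda>b. exp (\<mu> * (cmod (of_real (v * (\<beta> * sg b * \<sigma>)) + cis (a * (\<beta> * sg b) + \<theta>) * z))\<^sup>2)"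
  shows "(W True + W False) / 2 \<le> exp (2 * \<mu>) * exp (\<mu> * (1 + 2 * a\<^sup>2) * (cmod z)\<^sup>2)"
proof -
  define z' where "z' = cis \<theta> * z"
  have nz: "cmod z' = cmod z" by (simp add: z'_def norm_mult)
  define A where "A = v\<^sup>2 + (cmod z)\<^sup>2 - 2 * v * \<sigma> * sin a * Im z'"
  define B where "B = 2 * v * \<sigma> * cos a * Re z'"
  \<comment> \<open>The squared norm is affine in the sign \<open>c\<close>, with mean
    \<open>A\<close> and deviation \<open>B\<close>. The cross term survives in \<open>A\<close>
    only with the small factor \<open>sin a\<close>.\<close>
  have W: "(cmod (of_real (v * (c * \<sigma>)) + cis (a * c + \<theta>) * z))\<^sup>2 = A + c * B" if c: "c = 1 \<or> c = -1" for c
  proof -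
    have s2: "\<sigma>\<^sup>2 = 1" using \<sigma> by (metis power2_abs one_power2)
    have sc: "(sin a)\<^sup>2 = 1 - (cos a)\<^sup>2" by (simp add: sin_squared_eq)
    have "cis (a * c + \<theta>) * z = cis (a * c) * z'" by (simp add: z'_def cis_mult)
    then show ?thesis using c s2 unfolding A_def B_def nz[symmetric] cmod_power2
      by (auto simp: power2_sum power2_diff power_mult_distrib sc algebra_simps)
  qed
  have bb: "\<beta> = 1 \<or> \<beta> = -1" using \<beta> by linarith
  have "(W True + W False) / 2 = (exp (\<mu> * (A + B)) + exp (\<mu> * (A - B))) / 2"
    using bb W[of 1] W[of "-1"] unfolding W_def by (elim disjE) simp_all
  also have "\<dots> = exp (\<mu> * A) * cosh (\<mu> * B)"
    by (simp add: cosh_def exp_add exp_diff exp_minus distrib_left right_diff_distrib field_simps)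
  also have "\<dots> \<le> exp (\<mu> * A) * exp ((\<mu> * B)\<^sup>2 / 2)"
    by (intro mult_left_mono cosh_le_exp_half_square) auto
  also have "\<dots> = exp (\<mu> * (A + \<mu> * B\<^sup>2 / 2))"
    by (simp add: exp_add[symmetric] power2_eq_square algebra_simps)
  \<comment> \<open>Both errors are of size \<open>a\<^sup>2 * (cmod z)\<^sup>2\<close>: the
    variance term since \<open>\<mu> \<le> a\<^sup>2 / 2\<close>, the cross term by the
    arithmetic-geometric mean inequality at the cost of an additional 1.\<close>
  also have "\<dots> \<le> exp (\<mu> * (2 + (1 + 2 * a\<^sup>2) * (cmod z)\<^sup>2))"
  proof -
    have "\<bar>B\<bar> = 2 * (v * (\<bar>cos a\<bar> * \<bar>Re z'\<bar>))"
      using v \<sigma> by (simp add: B_def abs_mult)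
    also have "\<dots> \<le> 2 * (1 * (1 * cmod z))"
      using v abs_Re_le_cmod[of z'] nz by (intro mult_left_mono mult_mono) auto
    finally have "B\<^sup>2 \<le> (2 * cmod z)\<^sup>2" by (intro power2_le_iff_abs_le[THEN iffD2]) auto
    then have "\<mu> * B\<^sup>2 / 2 \<le> (a\<^sup>2 / 2) * (2 * cmod z)\<^sup>2 / 2"
      using \<mu> by (intro divide_right_mono mult_mono) auto
    then have 1: "\<mu> * B\<^sup>2 / 2 \<le> a\<^sup>2 * (cmod z)\<^sup>2" by (simp add: power_mult_distrib)
    have "\<bar>2 * v * \<sigma> * sin a * Im z'\<bar> = 2 * (v * (\<bar>sin a\<bar> * \<bar>Im z'\<bar>))"
      using v \<sigma> by (simp add: abs_mult)
    also have "\<dots> \<le> 2 * (1 * (\<bar>a\<bar> * cmod z))"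
      using v abs_Im_le_cmod[of z'] nz abs_sin_x_le_abs_x[of a] by (intro mult_left_mono mult_mono) auto
    also have "\<dots> \<le> 1 + a\<^sup>2 * (cmod z)\<^sup>2"
      using sum_squares_bound[of 1 "\<bar>a\<bar> * cmod z"] by (simp add: power_mult_distrib)
    finally have "- (2 * v * \<sigma> * sin a * Im z') \<le> 1 + a\<^sup>2 * (cmod z)\<^sup>2" by linarith
    moreover have "v\<^sup>2 \<le> 1" using v by (simp add: power_le_one)
    ultimately have "A + \<mu> * B\<^sup>2 / 2 \<le> 2 + (1 + 2 * a\<^sup>2) * (cmod z)\<^sup>2"
      using 1 unfolding A_def by (simp add: algebra_simps)
    then show ?thesis using \<mu> by (simp add: mult_left_mono)
  qed
  also have "\<dots> = exp (2 * \<mu>) * exp (\<mu> * (1 + 2 * a\<^sup>2) * (cmod z)\<^sup>2)"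
    by (simp add: exp_add[symmetric] algebra_simps)
  finally show ?thesis .
qed

text \<open>Each digit removed multiplies the parameter by \<open>1 + 2 * a\<^sup>2\<close> and
  costs a factor \<open>exp (2 * \<mu>)\<close>. Smallness of the final parameter keeps all
  intermediate ones admissible. For \<open>a\<^sup>2\<close> of order \<open>1 / N\<close> the
  growth is bounded, so \<open>U\<close> is sub-Gaussian at scale \<open>sqrt N\<close>.\<close>

lemma avg_exp_norm_square_le:
  fixes U :: "bool list \<Rightarrow> complex"
  assumes U0: "U [] = 0"
    and step: "\<And>us. length us < N \<Longrightarrow> \<exists>v \<sigma> \<beta> \<theta>. 0 \<le> v \<and> v \<le> 1 \<and> \<bar>\<sigma>\<bar> = 1 \<and> \<bar>\<beta>\<bar> = 1 \<and>
      (\<forall>b. U (us @ [b]) = of_real (v * (\<beta> * sg b * \<sigma>)) + cis (a * (\<beta> * sg b) + \<theta>) * U us)"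
    and "0 \<le> \<mu>" "\<mu> * (1 + 2 * a\<^sup>2) ^ N \<le> a\<^sup>2 / 2"
  shows "avg N (\<lambda>zs. exp (\<mu> * (cmod (U zs))\<^sup>2)) \<le> exp (2 * N * (\<mu> * (1 + 2 * a\<^sup>2) ^ N))"
  using assms(2-)
proof (induction N arbitrary: \<mu>)
  case 0
  then show ?case by (simp add: U0)
next
  case (Suc N)
  let ?q = "1 + 2 * a\<^sup>2"
  have q: "1 \<le> ?q ^ M" for M by (intro one_le_power) simp
  have "\<mu> * 1 \<le> \<mu> * ?q ^ Suc N" using Suc.prems q by (intro mult_left_mono)
  then have \<mu>: "\<mu> \<le> a\<^sup>2 / 2" using Suc.prems by linarith
  have "avg (Suc N) (\<lambda>zs. exp (\<mu> * (cmod (U zs))\<^sup>2))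
      \<le> avg N (\<lambda>us. exp (2 * \<mu>) * exp (\<mu> * ?q * (cmod (U us))\<^sup>2))"
    unfolding avg_Suc
  proof (rule avg_mono)
    fix us :: "bool list" assume "length us = N"
    then obtain v \<sigma> \<beta> \<theta> where *: "0 \<le> v" "v \<le> 1" "\<bar>\<sigma>\<bar> = 1" "\<bar>\<beta>\<bar> = 1"
      "\<And>b. U (us @ [b]) = of_real (v * (\<beta> * sg b * \<sigma>)) + cis (a * (\<beta> * sg b) + \<theta>) * U us"
      using Suc.prems(1)[of us] by auto
    show "(exp (\<mu> * (cmod (U (us @ [True])))\<^sup>2) + exp (\<mu> * (cmod (U (us @ [False])))\<^sup>2)) / 2
       \<le> exp (2 * \<mu>) * exp (\<mu> * ?q * (cmod (U us))\<^sup>2)"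
      unfolding *(5) using exp_norm_square_step[OF *(1-4) Suc.prems(2) \<mu>] .
  qed
  also have "\<dots> \<le> exp (2 * \<mu>) * exp (2 * real N * (\<mu> * ?q * ?q ^ N))"
    unfolding avg_cmult
  proof (intro mult_left_mono)
    have "\<mu> * ?q * ?q ^ N \<le> a\<^sup>2 / 2" using Suc.prems(3) by (simp only: power_Suc mult.assoc)
    moreover have "length us < N \<Longrightarrow> length us < Suc N" for us :: "bool list" by simp
    ultimately show "avg N (\<lambda>us. exp (\<mu> * ?q * (cmod (U us))\<^sup>2)) \<le> exp (2 * real N * (\<mu> * ?q * ?q ^ N))"
      using Suc.prems(1,2) by (intro Suc.IH[of "\<mu> * ?q"] mult_nonneg_nonneg) simp_all
  qed auto
  also have "\<dots> = exp (2 * \<mu> + 2 * real N * (\<mu> * ?q ^ Suc N))"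
    by (simp only: exp_add power_Suc mult.assoc)
  also have "\<dots> \<le> exp (2 * real (Suc N) * (\<mu> * ?q ^ Suc N))"
    using \<open>\<mu> * 1 \<le> \<mu> * ?q ^ Suc N\<close> by (simp only: exp_le_cancel_iff of_nat_Suc distrib_left distrib_right)
  finally show ?case .
qed

subsection \<open>Simultaneous small values of the planar sums\<close>

text \<open>The first coordinate is frozen: \<open>\<alpha> k\<close> gives the signs at first scale
  \<open>k\<close>, as functions of prefixes of the other two digit strings. The number
  \<open>a\<close> is the frequency of the cosines.\<close>

locale sign_system =
  fixes n :: nat and \<alpha> :: "nat \<Rightarrow> bool list \<Rightarrow> bool list \<Rightarrow> real" and a :: real
  assumes alpha: "\<bar>\<alpha> k us vs\<bar> = 1"
    and a: "0 \<le> a" "a \<le> 1"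
begin

text \<open>The three scales add up to \<open>n\<close>, so a prefix of length \<open>j\<close> in
  the second coordinate goes with the digit \<open>n - k - j\<close> of the third. The value 0 for
  \<open>j > n - k\<close> stops the walk and lets all \<open>k\<close> share one time
  range.\<close>

definition coef :: "nat \<Rightarrow> bool list \<Rightarrow> bool list \<Rightarrow> real" where
  "coef k us zs = (if length us \<le> n - k
     then \<alpha> k us (take (n - k - length us) zs) * sg (zs ! (n - k - length us)) else 0)"

definition trm :: "nat \<Rightarrow> nat \<Rightarrow> bool list \<Rightarrow> bool list \<Rightarrow> real" where
  "trm k j ys zs = sg (ys ! j) * coef k (take j ys) zs"

text \<open>The planar sum at scale \<open>k\<close> as a walk with unit steps, time being the digit
  position in the second coordinate.\<close>

definition walk :: "nat \<Rightarrow> bool list \<Rightarrow> bool list \<Rightarrow> real" where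
  "walk k us zs = (\<Sum>j<length us. trm k j us zs)"

text \<open>The truncated subtraction makes the weight \<open>1\<close> from step \<open>n + 1 - k\<close> on, where \<open>walk k\<close> has stopped.\<close>

definition weight :: "nat \<Rightarrow> nat \<Rightarrow> real" where
  "weight k j = cos a ^ (n + 1 - k - j)"

lemma cos_a: "0 \<le> cos a" "cos a \<le> 1"
  using a pi_gt3 by (auto intro!: cos_ge_zero)

lemma weight_bounds: "0 \<le> weight k j" "weight k j \<le> 1"
  using cos_a by (auto simp: weight_def intro: power_le_one)

lemma abs_coef: "\<bar>coef k us zs\<bar> \<le> 1"
  by (simp add: coef_def abs_mult alpha)

lemma trm_append: "j < length us \<Longrightarrow> trm k j (us @ vs) zs = trm k j us zs"
  by (simp add: trm_def nth_append)

lemma walk_snoc: "walk k (us @ [b]) zs = walk k us zs + sg b * coef k us zs"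
  by (simp add: walk_def trm_append) (simp add: trm_def)

lemma walk_take: "j \<le> length ys \<Longrightarrow> walk k (take j ys) zs = (\<Sum>i<j. trm k i ys zs)"
  by (simp add: walk_def trm_def)

section \<open>The cosine martingale in the second coordinate\<close>

definition cos_sum :: "nat \<Rightarrow> bool list \<Rightarrow> bool list \<Rightarrow> real" where
  "cos_sum m us zs = (\<Sum>k<m. weight k (length us) * cos (a * walk k us zs))"

definition sin_coef :: "nat \<Rightarrow> bool list \<Rightarrow> bool list \<Rightarrow> real" where
  "sin_coef k us zs = weight k (Suc (length us)) * sin (a * walk k us zs) * coef k us zs"

lemma abs_sin_coef: "\<bar>sin_coef k us zs\<bar> \<le> 1"
  unfolding sin_coef_def abs_mult
  using weight_bounds by (intro mult_le_one abs_coef) auto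

text \<open>By the addition formula a unit step multiplies the mean of the cosine by
  \<open>cos a\<close>, which the change of \<open>weight\<close> undoes; what remains is the new
  sign times a quantity fixed by the prefix. Once the walk has stopped, the weight is 1 and the
  increment 0.\<close>

lemma cos_sum_snoc:
  assumes "m \<le> n + 1"
  shows "cos_sum m (us @ [b]) zs = cos_sum m us zs - sg b * (sin a * (\<Sum>k<m. sin_coef k us zs))"
proof -
  have "weight k (Suc (length us)) * cos (a * walk k (us @ [b]) zs)
      = weight k (length us) * cos (a * walk k us zs) - sg b * (sin a * sin_coef k us zs)"
    if "k < m" for k
  proof (cases "length us \<le> n - k")
    case True
    define c where "c = sg b * coef k us zs"
    have c: "c = 1 \<or> c = -1"
      using True alpha[of k us "take (n - k - length us) zs"]
      by (auto simp: c_def coef_def sg_def abs_if split: if_splits)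
    then have 1: "cos (a * c) = cos a" "sin (a * c) = c * sin a" by auto
    have "n + 1 - k - length us = Suc (n + 1 - k - Suc (length us))"
      using True that assms by linarith
    then have 2: "weight k (length us) = cos a * weight k (Suc (length us))"
      by (simp add: weight_def)
    have "a * walk k (us @ [b]) zs = a * walk k us zs + a * c"
      by (simp add: walk_snoc c_def algebra_simps)
    then show ?thesis
      by (simp only: cos_add 1 2 sin_coef_def) (simp add: c_def algebra_simps)
  next
    case False
    then show ?thesis
      by (simp add: walk_snoc sin_coef_def coef_def weight_def)
  qed
  then show ?thesis
    by (simp add: cos_sum_def sum_subtractf sum_distrib_left)
qed

section \<open>Pairs of scales in the quadratic variation\<close>

definition pair_sum :: "nat \<Rightarrow> nat \<Rightarrow> bool list \<Rightarrow> bool list \<Rightarrow> real" where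
  "pair_sum k k' ys zs = (\<Sum>j<n+1. sin_coef k (take j ys) zs * sin_coef k' (take j ys) zs)"

lemma pair_sum_commute: "pair_sum k k' = pair_sum k' k"
  by (simp add: pair_sum_def fun_eq_iff mult.commute)

text \<open>Complex form of the cosines of the difference (\<open>\<tau> = -1\<close>) and of the
  sum (\<open>\<tau> = 1\<close>) of two walks. Both the outer sum and the phases start at
  \<open>j\<close>, so lowering \<open>j\<close> by one rotates the old value and adds one
  term.\<close>

definition pair_phase :: "real \<Rightarrow> nat \<Rightarrow> nat \<Rightarrow> nat \<Rightarrow> bool list \<Rightarrow> bool list \<Rightarrow> complex" where
  "pair_phase \<tau> k k' j ys zs = (\<Sum>i\<in>{j..n - k'}.
     of_real (weight k (Suc i) * weight k' (Suc i) * (trm k i ys zs * trm k' i ys zs))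
       * cis (a * (\<Sum>l\<in>{j..<i}. trm k l ys zs + \<tau> * trm k' l ys zs)))"

text \<open>Past \<open>j = n - k'\<close> the coefficient of \<open>k'\<close> vanishes. Before
  that the product formula for sines applies, and \<open>coef\<close> may be replaced by
  \<open>trm\<close> because the digit \<open>ys ! j\<close> squares to 1.\<close>

lemma pair_sum_eq:
  assumes "k < k'" "k' \<le> n" "length ys = n + 1"
  shows "pair_sum k k' ys zs
    = (Re (pair_phase (-1) k k' 0 ys zs) - Re (pair_phase 1 k k' 0 ys zs)) / 2"
proof -
  have "pair_sum k k' ys zs = (\<Sum>j\<in>{0..n - k'}. sin_coef k (take j ys) zs * sin_coef k' (take j ys) zs)"
    unfolding pair_sum_def using assms
    by (intro sum.mono_neutral_right) (auto simp: sin_coef_def coef_def)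
  also have "\<dots> = (\<Sum>j\<in>{0..n - k'}. weight k (Suc j) * weight k' (Suc j) * (trm k j ys zs * trm k' j ys zs)
     * ((cos (a * (\<Sum>l<j. trm k l ys zs) - a * (\<Sum>l<j. trm k' l ys zs))
       - cos (a * (\<Sum>l<j. trm k l ys zs) + a * (\<Sum>l<j. trm k' l ys zs))) / 2))"
  proof (intro sum.cong refl)
    fix j assume "j \<in> {0..n - k'}"
    then have j: "j \<le> length ys" "j \<le> n" using assms by auto
    have "trm k j ys zs * trm k' j ys zs = coef k (take j ys) zs * coef k' (take j ys) zs * (sg (ys ! j) * sg (ys ! j))"
      by (simp add: trm_def del: sg_simps)
    then have 1: "trm k j ys zs * trm k' j ys zs = coef k (take j ys) zs * coef k' (take j ys) zs" by simp
    show "sin_coef k (take j ys) zs * sin_coef k' (take j ys) zs = weight k (Suc j) * weight k' (Suc j) * (trm k j ys zs * trm k' j ys zs)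
     * ((cos (a * (\<Sum>l<j. trm k l ys zs) - a * (\<Sum>l<j. trm k' l ys zs))
       - cos (a * (\<Sum>l<j. trm k l ys zs) + a * (\<Sum>l<j. trm k' l ys zs))) / 2)"
      unfolding 1 sin_times_sin[symmetric] sin_coef_def walk_take[OF j(1)] using assms j by simp
  qed
  also have "\<dots> = (Re (pair_phase (-1) k k' 0 ys zs) - Re (pair_phase 1 k k' 0 ys zs)) / 2"
    by (simp add: pair_phase_def atLeast0LessThan sum.distrib sum_subtractf sum_negf
        right_diff_distrib distrib_left flip: sum_divide_distrib)
  finally show ?thesis .
qed

text \<open>Revealing the third coordinate from coarse to fine scales peels off the summands of
  \<open>pair_phase\<close> from \<open>j = n - k'\<close> down to \<open>j = 0\<close>; the factor \<open>trm k j\<close> carries the new digit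
  while \<open>trm k' j\<close> with \<open>k < k'\<close> is already determined.\<close>

lemma coef_append: "n - k - length us < length zs \<Longrightarrow> coef k us (zs @ ws) = coef k us zs"
  by (simp add: coef_def nth_append)

lemma abs_trm: "j \<le> n - k \<Longrightarrow> \<bar>trm k j ys zs\<bar> = 1"
  by (auto simp: trm_def coef_def abs_mult alpha)

lemma pair_phase_step:
  assumes k: "k < k'" "k' \<le> n" and us: "length us < n + 1 - k" and ys: "length ys = n + 1"
  shows "\<exists>v \<sigma> \<beta> \<theta>. 0 \<le> v \<and> v \<le> 1 \<and> \<bar>\<sigma>\<bar> = 1 \<and> \<bar>\<beta>\<bar> = 1 \<and>
    (\<forall>b. pair_phase \<tau> k k' (n + 1 - k - length (us @ [b])) ys (us @ [b])
      = of_real (v * (\<beta> * sg b * \<sigma>)) + cis (a * (\<beta> * sg b) + \<theta>)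
          * pair_phase \<tau> k k' (n + 1 - k - length us) ys us)"
proof -
  define j where "j = n - k - length us"
  have len: "n + 1 - k - length us = Suc j" "length us = n - k - j" "j \<le> n - k"
    using us k by (auto simp: j_def)
  have len_snoc: "n + 1 - k - length (us @ [b]) = j" for b using len by simp
  show ?thesis
  proof (cases "j \<le> n - k'")
    \<comment> \<open>Both phase sums are empty here, so \<open>v = 0\<close> works.\<close>
    case False
    then show ?thesis unfolding len(1) len_snoc
      by (intro exI[of _ 0] exI[of _ 1]) (simp add: pair_phase_def)
  next
    case True
    have old: "trm k i ys (us @ [b]) = trm k i ys us" if "Suc j \<le> i" "i \<le> n - k'" for i b
      unfolding trm_def using that len k ys by (subst coef_append) auto
    \<comment> \<open>At scale \<open>k'\<close> the digit read is at position
      \<open>n - k' - i\<close>, strictly before \<open>n - k - i\<close>, so that even the term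
      with \<open>i = j\<close> is already determined.\<close>
    have old': "trm k' i ys (us @ [b]) = trm k' i ys us" if "j \<le> i" "i \<le> n - k'" for i b
      unfolding trm_def using that len k ys by (subst coef_append) auto
    define v where "v = weight k (Suc j) * weight k' (Suc j)"
    define \<beta> where "\<beta> = sg (ys ! j) * \<alpha> k (take j ys) us"
    define \<sigma> where "\<sigma> = trm k' j ys us"
    have new: "trm k j ys (us @ [b]) = \<beta> * sg b" for b
      using len True ys k by (simp add: trm_def coef_def \<beta>_def nth_append)
    have "pair_phase \<tau> k k' j ys (us @ [b]) = of_real (v * (\<beta> * sg b * \<sigma>))
        + cis (a * (\<beta> * sg b) + a * \<tau> * \<sigma>) * pair_phase \<tau> k k' (Suc j) ys us" for b
    proof -
      have "cis (a * (\<Sum>l\<in>{j..<i}. trm k l ys (us @ [b]) + \<tau> * trm k' l ys (us @ [b])))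
          = cis (a * (\<beta> * sg b) + a * \<tau> * \<sigma>)
            * cis (a * (\<Sum>l\<in>{Suc j..<i}. trm k l ys us + \<tau> * trm k' l ys us))"
        if i: "i \<in> {Suc j..n - k'}" for i
      proof -
        have "(\<Sum>l\<in>{j..<i}. trm k l ys (us @ [b]) + \<tau> * trm k' l ys (us @ [b]))
           = \<beta> * sg b + \<tau> * \<sigma> + (\<Sum>l\<in>{Suc j..<i}. trm k l ys (us @ [b]) + \<tau> * trm k' l ys (us @ [b]))"
          using i True by (simp add: sum.atLeast_Suc_lessThan new old' \<sigma>_def)
        also have "(\<Sum>l\<in>{Suc j..<i}. trm k l ys (us @ [b]) + \<tau> * trm k' l ys (us @ [b]))
           = (\<Sum>l\<in>{Suc j..<i}. trm k l ys us + \<tau> * trm k' l ys us)"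
          using i by (intro sum.cong refl) (simp add: old old')
        finally show ?thesis by (simp add: cis_mult algebra_simps)
      qed
      note phase = this
      have "(\<Sum>i\<in>{Suc j..n - k'}.
          of_real (weight k (Suc i) * weight k' (Suc i) * (trm k i ys (us @ [b]) * trm k' i ys (us @ [b])))
          * cis (a * (\<Sum>l\<in>{j..<i}. trm k l ys (us @ [b]) + \<tau> * trm k' l ys (us @ [b]))))
        = cis (a * (\<beta> * sg b) + a * \<tau> * \<sigma>) * pair_phase \<tau> k k' (Suc j) ys us"
        unfolding pair_phase_def sum_distrib_left[where r = "cis (a * (\<beta> * sg b) + a * \<tau> * \<sigma>)"]
      proof (intro sum.cong refl)
        fix i assume i: "i \<in> {Suc j..n - k'}"
        then show "of_real (weight k (Suc i) * weight k' (Suc i) * (trm k i ys (us @ [b]) * trm k' i ys (us @ [b])))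
          * cis (a * (\<Sum>l\<in>{j..<i}. trm k l ys (us @ [b]) + \<tau> * trm k' l ys (us @ [b])))
          = cis (a * (\<beta> * sg b) + a * \<tau> * \<sigma>)
            * (of_real (weight k (Suc i) * weight k' (Suc i) * (trm k i ys us * trm k' i ys us))
              * cis (a * (\<Sum>l\<in>{Suc j..<i}. trm k l ys us + \<tau> * trm k' l ys us)))"
          unfolding phase[OF i] by (simp add: old old')
      qed
      then show ?thesis
        using True unfolding pair_phase_def[of _ _ _ j]
        by (subst sum.atLeast_Suc_atMost) (simp_all add: v_def new old' \<sigma>_def mult.assoc)
    qed
    moreover have "0 \<le> v" "v \<le> 1" "\<bar>\<sigma>\<bar> = 1" "\<bar>\<beta>\<bar> = 1"
      using weight_bounds True alpha
      by (auto simp: v_def \<sigma>_def \<beta>_def abs_trm abs_mult intro!: mult_le_one)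
    ultimately show ?thesis unfolding len(1) len_snoc by blast
  qed
qed

text \<open>The last digit of the third coordinate that scales \<open>k\<close> and
  \<open>k'\<close> can read has position \<open>n - k\<close>.\<close>

lemma pair_phase_take:
  assumes "k < k'" "k' \<le> n" "length ys = n + 1" "length zs = n + 1"
  shows "pair_phase \<tau> k k' 0 ys (take (n + 1 - k) zs) = pair_phase \<tau> k k' 0 ys zs"
proof -
  have "trm l i ys (take (n + 1 - k) zs) = trm l i ys zs" if "l = k \<or> l = k'" "i \<le> n - k'" for l i
  proof -
    have "trm l i ys (take (n + 1 - k) zs @ drop (n + 1 - k) zs) = trm l i ys (take (n + 1 - k) zs)"
      unfolding trm_def using that assms by (subst coef_append) auto
    then show ?thesis by simp
  qed
  note eq = this
  show ?thesis unfolding pair_phase_def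
  proof (intro sum.cong refl)
    fix i assume i: "i \<in> {0..n - k'}"
    have "(\<Sum>l\<in>{0..<i}. trm k l ys (take (n + 1 - k) zs) + \<tau> * trm k' l ys (take (n + 1 - k) zs))
        = (\<Sum>l\<in>{0..<i}. trm k l ys zs + \<tau> * trm k' l ys zs)"
      using i by (intro sum.cong refl) (simp add: eq del: One_nat_def add_Suc_right)
    then show "of_real (weight k (Suc i) * weight k' (Suc i)
          * (trm k i ys (take (n + 1 - k) zs) * trm k' i ys (take (n + 1 - k) zs)))
        * cis (a * (\<Sum>l\<in>{0..<i}. trm k l ys (take (n + 1 - k) zs) + \<tau> * trm k' l ys (take (n + 1 - k) zs)))
      = of_real (weight k (Suc i) * weight k' (Suc i) * (trm k i ys zs * trm k' i ys zs))
        * cis (a * (\<Sum>l\<in>{0..<i}. trm k l ys zs + \<tau> * trm k' l ys zs))"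
      using eq[of k i] eq[of k' i] i by (simp only: simp_thms atLeastAtMost_iff)
  qed
qed

definition phase_bound :: "real \<Rightarrow> real" where
  "phase_bound \<mu> = exp (2 * real (n + 1) * (\<mu> * (1 + 2 * a\<^sup>2) ^ (n + 1)))"

lemma avg_exp_pair_phase:
  assumes "k < k'" "k' \<le> n" "length ys = n + 1" "0 \<le> \<mu>" "\<mu> * (1 + 2 * a\<^sup>2) ^ (n + 1) \<le> a\<^sup>2 / 2"
  shows "avg (n + 1) (\<lambda>zs. exp (\<mu> * (cmod (pair_phase \<tau> k k' 0 ys zs))\<^sup>2)) \<le> phase_bound \<mu>"
proof -
  let ?N = "n + 1 - k"
  \<comment> \<open>The summands determined by \<open>us\<close> are those from this index on; for
    \<open>us = []\<close> the range is empty.\<close>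
  define U where "U = (\<lambda>us. pair_phase \<tau> k k' (?N - length us) ys us)"
  have pw: "\<mu> * (1 + 2 * a\<^sup>2) ^ ?N \<le> \<mu> * (1 + 2 * a\<^sup>2) ^ (n + 1)"
    using assms by (intro mult_left_mono power_increasing) auto
  have "avg (n + 1) (\<lambda>zs. exp (\<mu> * (cmod (pair_phase \<tau> k k' 0 ys zs))\<^sup>2))
      = avg (n + 1) (\<lambda>zs. exp (\<mu> * (cmod (U (take ?N zs)))\<^sup>2))"
  proof (rule avg_cong)
    fix zs :: "bool list" assume zs: "length zs = n + 1"
    then have "U (take ?N zs) = pair_phase \<tau> k k' 0 ys (take ?N zs)" by (simp add: U_def)
    also have "\<dots> = pair_phase \<tau> k k' 0 ys zs" using assms zs by (intro pair_phase_take) auto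
    finally show "exp (\<mu> * (cmod (pair_phase \<tau> k k' 0 ys zs))\<^sup>2) = exp (\<mu> * (cmod (U (take ?N zs)))\<^sup>2)"
      by simp
  qed
  also have "\<dots> = avg ?N (\<lambda>zs. exp (\<mu> * (cmod (U zs))\<^sup>2))"
    by (rule avg_take[where \<phi> = "\<lambda>zs. exp (\<mu> * (cmod (U zs))\<^sup>2)"]) simp
  also have "\<dots> \<le> exp (2 * real ?N * (\<mu> * (1 + 2 * a\<^sup>2) ^ ?N))"
  proof (rule avg_exp_norm_square_le)
    show "U [] = 0" using assms by (simp add: U_def pair_phase_def)
    show "\<mu> * (1 + 2 * a\<^sup>2) ^ ?N \<le> a\<^sup>2 / 2" using pw assms by linarith
  next
    fix us :: "bool list" assume "length us < ?N"
    from pair_phase_step[OF assms(1,2) this assms(3), of \<tau>]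
    show "\<exists>v \<sigma> \<beta> \<theta>. 0 \<le> v \<and> v \<le> 1 \<and> \<bar>\<sigma>\<bar> = 1 \<and> \<bar>\<beta>\<bar> = 1 \<and>
      (\<forall>b. U (us @ [b]) = of_real (v * (\<beta> * sg b * \<sigma>)) + cis (a * (\<beta> * sg b) + \<theta>) * U us)"
      unfolding U_def .
  qed fact
  also have "\<dots> \<le> phase_bound \<mu>"
    unfolding phase_bound_def exp_le_cancel_iff
  proof (rule mult_mono[OF _ pw])
    show "2 * real ?N \<le> 2 * real (n + 1)" by simp
  qed (use assms in auto)
  finally show ?thesis .
qed

text \<open>Young's inequality
  \<open>c * t \<le> c\<^sup>2 / (4 * \<mu>) + \<mu> * t\<^sup>2\<close> reduces the exponential
  moment to the Gaussian moments of the two phase sums. The case \<open>k > k'\<close> follows by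
  symmetry.\<close>

lemma avg_exp_pair_sum:
  assumes "k \<noteq> k'" "k \<le> n" "k' \<le> n" "length ys = n + 1"
    and \<mu>: "0 < \<mu>" "\<mu> * (1 + 2 * a\<^sup>2) ^ (n + 1) \<le> a\<^sup>2 / 2" and "0 \<le> c"
  shows "avg (n + 1) (\<lambda>zs. exp (c * \<bar>pair_sum k k' ys zs\<bar>)) \<le> exp (c\<^sup>2 / (4 * \<mu>)) * phase_bound \<mu>"
  using assms(1-3)
proof (induction k k' rule: linorder_wlog)
  case (le k k')
  then have k: "k < k'" "k' \<le> n" by auto
  define E where "E = (\<lambda>\<tau> zs. exp (\<mu> * (cmod (pair_phase \<tau> k k' 0 ys zs))\<^sup>2))"
  have "avg (n + 1) (\<lambda>zs. exp (c * \<bar>pair_sum k k' ys zs\<bar>))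
      \<le> avg (n + 1) (\<lambda>zs. exp (c\<^sup>2 / (4 * \<mu>)) / 2 * (E (-1) zs + E 1 zs))"
  proof (rule avg_mono)
    fix zs
    let ?V = "\<lambda>\<tau>. cmod (pair_phase \<tau> k k' 0 ys zs)"
    have young: "exp (c * t) \<le> exp (c\<^sup>2 / (4 * \<mu>)) * exp (\<mu> * t\<^sup>2)" for t :: real
    proof -
      have "0 \<le> (2 * \<mu> * t - c)\<^sup>2 / (4 * \<mu>)" using \<mu> by simp
      also have "\<dots> = c\<^sup>2 / (4 * \<mu>) + \<mu> * t\<^sup>2 - c * t"
        using \<mu> by (simp add: power2_diff power_mult_distrib field_simps power2_eq_square)
      finally show ?thesis by (simp flip: exp_add)
    qed
    have "\<bar>pair_sum k k' ys zs\<bar> \<le> (?V (-1) + ?V 1) / 2"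
      unfolding pair_sum_eq[OF k assms(4)]
      using abs_Re_le_cmod[of "pair_phase (-1) k k' 0 ys zs"] abs_Re_le_cmod[of "pair_phase 1 k k' 0 ys zs"]
        abs_triangle_ineq4[of "Re (pair_phase (-1) k k' 0 ys zs)" "Re (pair_phase 1 k k' 0 ys zs)"]
      by simp
    then have "exp (c * \<bar>pair_sum k k' ys zs\<bar>) \<le> exp (c * ((?V (-1) + ?V 1) / 2))"
      using \<open>0 \<le> c\<close> by (simp only: exp_le_cancel_iff mult_left_mono)
    also have "\<dots> \<le> (exp (c * ?V (-1)) + exp (c * ?V 1)) / 2"
      using exp_mean_le[of UNIV "\<lambda>b. c * ?V (sg b)"] by (simp add: UNIV_bool distrib_left add.commute)
    also have "\<dots> \<le> (exp (c\<^sup>2 / (4 * \<mu>)) * E (-1) zs + exp (c\<^sup>2 / (4 * \<mu>)) * E 1 zs) / 2"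
      unfolding E_def by (intro divide_right_mono add_mono young) auto
    finally show "exp (c * \<bar>pair_sum k k' ys zs\<bar>) \<le> exp (c\<^sup>2 / (4 * \<mu>)) / 2 * (E (-1) zs + E 1 zs)"
      by (simp add: distrib_left add_divide_distrib)
  qed
  also have "\<dots> = exp (c\<^sup>2 / (4 * \<mu>)) / 2 * (avg (n + 1) (E (-1)) + avg (n + 1) (E 1))"
    by (simp only: avg_cmult avg_add)
  also have "\<dots> \<le> exp (c\<^sup>2 / (4 * \<mu>)) / 2 * (phase_bound \<mu> + phase_bound \<mu>)"
    unfolding E_def using \<mu> by (intro mult_left_mono add_mono avg_exp_pair_phase k assms(4)) auto
  finally show ?case by simp
next
  case (sym k k')
  then show ?case using pair_sum_commute by metis
qed


text \<open>Expanding the square produces all pairs of scales. The diagonal is bounded trivially;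
  the off-diagonal pairs are kept, since cancellation in the third coordinate makes them
  small.\<close>

lemma sum_sin_coef_squares_le:
  assumes "0 < m"
  shows "(\<Sum>j<n+1. (\<Sum>k<m. sin_coef k (take j ys) zs)\<^sup>2)
    \<le> real m * real (n + 1) + (\<Sum>(k, k')\<in>{..<m} \<times> {..<m}. if k = k' then 0 else \<bar>pair_sum k k' ys zs\<bar>)"
proof -
  have "(\<Sum>j<n+1. (\<Sum>k<m. sin_coef k (take j ys) zs)\<^sup>2) = (\<Sum>(k, k')\<in>{..<m} \<times> {..<m}. pair_sum k k' ys zs)"
  proof -
    have "(\<Sum>j<n+1. (\<Sum>k<m. sin_coef k (take j ys) zs)\<^sup>2)
        = (\<Sum>j<n+1. \<Sum>p\<in>{..<m} \<times> {..<m}. sin_coef (fst p) (take j ys) zs * sin_coef (snd p) (take j ys) zs)"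
      by (simp only: power2_eq_square sum_product sum.cartesian_product case_prod_unfold)
    also have "\<dots> = (\<Sum>p\<in>{..<m} \<times> {..<m}. pair_sum (fst p) (snd p) ys zs)"
      unfolding pair_sum_def by (rule sum.swap)
    finally show ?thesis by (simp only: case_prod_unfold)
  qed
  also have "\<dots> \<le> (\<Sum>(k, k')\<in>{..<m} \<times> {..<m}. (if k = k' then real (n + 1) else 0)
      + (if k = k' then 0 else \<bar>pair_sum k k' ys zs\<bar>))"
  proof -
    have "pair_sum k k ys zs \<le> (\<Sum>j<n+1. 1)" for k
      unfolding pair_sum_def
    proof (rule sum_mono)
      fix j
      show "sin_coef k (take j ys) zs * sin_coef k (take j ys) zs \<le> 1"
        using abs_sin_coef[of k "take j ys" zs] by (simp add: abs_square_le_1 flip: power2_eq_square)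
    qed
    then show ?thesis by (intro sum_mono) auto
  qed
  also have "\<dots> = real m * real (n + 1) + (\<Sum>(k, k')\<in>{..<m} \<times> {..<m}. if k = k' then 0 else \<bar>pair_sum k k' ys zs\<bar>)"
  proof -
    have "(\<Sum>(k, k')\<in>{..<m} \<times> {..<m}. if k = k' then x else 0) = real m * x" for x :: real
      by (simp add: sum.cartesian_product[symmetric])
    then show ?thesis by (simp only: case_prod_unfold sum.distrib)
  qed
  finally show ?thesis .
qed

text \<open>With \<open>S\<close> half the sum of squared increments of
  \<open>2 * \<kappa> * cos_sum m\<close>, the exponent is the mean of
  \<open>2 * \<kappa> * cos_sum m - S - \<Phi>\<close> and \<open>S + \<Phi>\<close>. Jensen
  separates them: the first is a compensated martingale in the second coordinate, the second is
  controlled through the third. The shift \<open>\<Phi>\<close> balances the two.\<close>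

lemma avg_exp_sum_cos_le:
  assumes m: "0 < m" "m \<le> n + 1" and "0 \<le> \<kappa>"
    and \<mu>: "0 < \<mu>" "\<mu> * (1 + 2 * a\<^sup>2) ^ (n + 1) \<le> a\<^sup>2 / 2"
  defines "c \<equiv> 2 * \<kappa>\<^sup>2 * a\<^sup>2 * (real m)\<^sup>2"
  shows "avg (n + 1) (\<lambda>ys. avg (n + 1) (\<lambda>zs. exp (\<kappa> * (\<Sum>k<m. cos (a * walk k ys zs)))))
    \<le> exp (\<kappa> * (\<Sum>k<m. cos a ^ (n + 1 - k))) / 2
      * (1 + exp (2 * \<kappa>\<^sup>2 * a\<^sup>2 * (real m * real (n + 1))) * (exp (c\<^sup>2 / (4 * \<mu>)) * phase_bound \<mu>))"
proof -
  define N where "N = n + 1"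
  define Q where "Q = (\<lambda>us zs. - (2 * \<kappa> * (sin a * (\<Sum>k<m. sin_coef k us zs))))"
  define S where "S = (\<lambda>ys zs. (\<Sum>j<N. (Q (take j ys) zs)\<^sup>2) / 2)"
  define \<Phi> where "\<Phi> = \<kappa> * (\<Sum>k<m. cos a ^ (n + 1 - k))"
  define G where "G = (\<lambda>ys zs. exp (2 * \<kappa> * cos_sum m ys zs - S ys zs))"
  define pp where "pp = (\<lambda>p ys zs. if fst p = snd p then 0 else \<bar>pair_sum (fst p) (snd p) ys zs\<bar>)"
  define I where "I = {..<m} \<times> {..<m}"
  define D where "D = exp (2 * \<kappa>\<^sup>2 * a\<^sup>2 * (real m * real N))"
  define B where "B = exp (c\<^sup>2 / (4 * \<mu>)) * phase_bound \<mu>"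
  have I: "finite I" "I \<noteq> {}" "real (card I) = (real m)\<^sup>2"
    using m by (auto simp: I_def power2_eq_square)
  have c0: "0 \<le> c" using \<open>0 \<le> \<kappa>\<close> by (simp add: c_def)
  have avg_G: "avg N (\<lambda>ys. G ys zs) \<le> exp (2 * \<Phi>)" for zs
  proof -
    have "2 * \<kappa> * cos_sum m (us @ [b]) zs = 2 * \<kappa> * cos_sum m us zs + sg b * Q us zs" for us b
      unfolding cos_sum_snoc[OF m(2)] by (simp add: Q_def algebra_simps)
    from avg_exp_compensated_le[where P = "\<lambda>us. 2 * \<kappa> * cos_sum m us zs" and Q = "\<lambda>us. Q us zs" and N = N, OF this]
    have "avg N (\<lambda>ys. G ys zs) \<le> exp (2 * \<kappa> * cos_sum m [] zs)"
      by (simp only: G_def S_def)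
    then show ?thesis by (simp add: \<Phi>_def cos_sum_def weight_def walk_def mult.assoc)
  qed
  \<comment> \<open>Jensen over the \<open>m\<^sup>2\<close> pairs replaces the joint law of the
    pair sums by individual exponential moments. The factor \<open>m\<^sup>2\<close> is contained in
    \<open>c\<close>.\<close>
  have exp_S: "exp (S ys zs) \<le> D * ((\<Sum>p\<in>I. exp (c * pp p ys zs)) / (real m)\<^sup>2)" for ys zs
  proof -
    have sin2: "(sin a)\<^sup>2 \<le> a\<^sup>2"
      using abs_sin_x_le_abs_x[of a] by (simp only: abs_le_square_iff)
    have "S ys zs = 2 * \<kappa>\<^sup>2 * (sin a)\<^sup>2 * (\<Sum>j<n+1. (\<Sum>k<m. sin_coef k (take j ys) zs)\<^sup>2)"
      by (simp add: S_def Q_def N_def power_mult_distrib mult.assoc flip: sum_distrib_left)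
    also have "\<dots> \<le> 2 * \<kappa>\<^sup>2 * a\<^sup>2 * (real m * real N + (\<Sum>p\<in>I. pp p ys zs))"
      using sum_sin_coef_squares_le[OF m(1), of ys zs]
      by (intro mult_mono mult_left_mono sin2) (auto simp: I_def pp_def N_def case_prod_unfold intro!: sum_nonneg add_nonneg_nonneg)
    also have "\<dots> = 2 * \<kappa>\<^sup>2 * a\<^sup>2 * (real m * real N) + (\<Sum>p\<in>I. c * pp p ys zs) / card I"
      using m unfolding I(3) c_def sum_distrib_left[symmetric] by (simp add: field_simps)
    finally have "exp (S ys zs) \<le> D * exp ((\<Sum>p\<in>I. c * pp p ys zs) / card I)"
      unfolding D_def exp_add[symmetric] by simp
    also have "\<dots> \<le> D * ((\<Sum>p\<in>I. exp (c * pp p ys zs)) / card I)"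
      by (intro mult_left_mono exp_mean_le I) (simp add: D_def)
    finally show ?thesis by (simp only: I(3))
  qed
  have pp: "avg N (\<lambda>zs. exp (c * pp p ys zs)) \<le> B" if "p \<in> I" "length ys = N" for p ys
  proof (cases "fst p = snd p")
    case True
    have "1 \<le> exp (c\<^sup>2 / (4 * \<mu>)) * phase_bound \<mu>"
      using \<mu> mult_mono[of 1 "exp (c\<^sup>2 / (4 * \<mu>))" 1 "phase_bound \<mu>"] by (simp add: phase_bound_def)
    with True show ?thesis by (simp add: pp_def B_def)
  next
    case False
    with that m show ?thesis unfolding pp_def B_def N_def
      using avg_exp_pair_sum[of "fst p" "snd p" ys \<mu> c] \<mu> c0 by (auto simp: I_def N_def)
  qed
  have avg_S: "avg N (\<lambda>ys. avg N (\<lambda>zs. exp (S ys zs))) \<le> D * B"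
  proof -
    have "avg N (\<lambda>zs. exp (S ys zs)) \<le> D * B" if ys: "length ys = N" for ys
    proof -
      have "avg N (\<lambda>zs. exp (S ys zs)) \<le> avg N (\<lambda>zs. D / (real m)\<^sup>2 * (\<Sum>p\<in>I. exp (c * pp p ys zs)))"
        using exp_S[of ys] by (intro avg_mono) simp
      also have "\<dots> = D / (real m)\<^sup>2 * (\<Sum>p\<in>I. avg N (\<lambda>zs. exp (c * pp p ys zs)))"
        by (simp only: avg_cmult avg_sum)
      also have "\<dots> \<le> D / (real m)\<^sup>2 * (\<Sum>p\<in>I. B)"
        using ys by (intro mult_left_mono sum_mono pp) (auto simp: D_def)
      also have "\<dots> = D * B" using m I(3) by simp
      finally show ?thesis .
    qed
    then have "avg N (\<lambda>ys. avg N (\<lambda>zs. exp (S ys zs))) \<le> avg N (\<lambda>ys. D * B)"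
      by (rule avg_mono)
    then show ?thesis by simp
  qed
  have "avg N (\<lambda>ys. avg N (\<lambda>zs. exp (\<kappa> * (\<Sum>k<m. cos (a * walk k ys zs)))))
      \<le> avg N (\<lambda>ys. avg N (\<lambda>zs. exp (- \<Phi>) / 2 * G ys zs + exp \<Phi> / 2 * exp (S ys zs)))"
  proof (intro avg_mono)
    fix ys zs :: "bool list" assume "length ys = N"
    then have "cos_sum m ys zs = (\<Sum>k<m. cos (a * walk k ys zs))"
      by (simp add: cos_sum_def weight_def N_def)
    then have "exp (\<kappa> * (\<Sum>k<m. cos (a * walk k ys zs))) = exp (((2 * \<kappa> * cos_sum m ys zs - S ys zs - \<Phi>) + (S ys zs + \<Phi>)) / 2)"
      by simp
    also have "\<dots> \<le> (exp (2 * \<kappa> * cos_sum m ys zs - S ys zs - \<Phi>) + exp (S ys zs + \<Phi>)) / 2"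
      using exp_mean_le[of UNIV "\<lambda>b. if b then S ys zs + \<Phi> else 2 * \<kappa> * cos_sum m ys zs - S ys zs - \<Phi>"]
      by (simp add: UNIV_bool)
    finally show "exp (\<kappa> * (\<Sum>k<m. cos (a * walk k ys zs))) \<le> exp (- \<Phi>) / 2 * G ys zs + exp \<Phi> / 2 * exp (S ys zs)"
      by (simp add: G_def exp_add exp_diff exp_minus field_simps)
  qed
  \<comment> \<open>The martingale part has to be averaged over \<open>ys\<close> for fixed
    \<open>zs\<close>, the part with \<open>S\<close> over \<open>zs\<close> for fixed
    \<open>ys\<close>.\<close>
  also have "\<dots> = exp (- \<Phi>) / 2 * avg N (\<lambda>zs. avg N (\<lambda>ys. G ys zs)) + exp \<Phi> / 2 * avg N (\<lambda>ys. avg N (\<lambda>zs. exp (S ys zs)))"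
    by (simp only: avg_add avg_cmult avg_swap[of N N G])
  also have "\<dots> \<le> exp (- \<Phi>) / 2 * avg N (\<lambda>zs. exp (2 * \<Phi>)) + exp \<Phi> / 2 * (D * B)"
    by (intro add_mono mult_left_mono avg_mono avg_G avg_S) auto
  also have "\<dots> = exp \<Phi> / 2 * (1 + D * B)"
  proof -
    have "exp (2 * \<Phi>) = exp \<Phi> * exp \<Phi>" by (simp flip: exp_add)
    then show ?thesis by (simp add: exp_minus field_simps)
  qed
  finally show ?thesis by (simp only: N_def \<Phi>_def D_def B_def)
qed

end

subsection \<open>The sum in terms of digits\<close>

text \<open>The planar sum at first scale \<open>k = length us\<close>; the prefix \<open>us\<close>
  is all that it sees of the first coordinate.\<close>

definition slice :: "nat \<Rightarrow> (bool list \<Rightarrow> bool list \<Rightarrow> bool list \<Rightarrow> real) \<Rightarrow> bool list \<Rightarrow> bool list \<Rightarrow> bool list \<Rightarrow> real" where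
  "slice n A us ys zs = (\<Sum>j<n + 1 - length us. sg (ys ! j) *
     (A us (take j ys) (take (n - length us - j) zs) * sg (zs ! (n - length us - j))))"

text \<open>The scales \<open>k \<le> n div 2\<close> are those with
  \<open>2 powr (- real k) \<ge> 2 powr (- real n / 2)\<close>.\<close>

definition digit_sum :: "nat \<Rightarrow> (bool list \<Rightarrow> bool list \<Rightarrow> bool list \<Rightarrow> real) \<Rightarrow> bool list \<Rightarrow> bool list \<Rightarrow> bool list \<Rightarrow> real" where
  "digit_sum n A xs ys zs = (\<Sum>k<n div 2 + 1. sg (xs ! k) * slice n A (take k xs) ys zs)"

text \<open>Covers bounded \<open>n\<close>. A digit that occurs in a single summand is flipped:
  first digit \<open>n - k\<close> of the second coordinate in the slice \<open>k = n div 2\<close>,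
  then the last digit of the first coordinate. Each flip changes the value by at least 2, so one
  choice has modulus at least 1.\<close>

lemma digit_sum_ge_1:
  assumes A: "\<And>us vs ws. \<bar>A us vs ws\<bar> = 1"
  shows "\<exists>xs ys zs. length xs = n div 2 + 1 \<and> length ys = n + 1 \<and> length zs = n + 1
     \<and> 1 \<le> \<bar>digit_sum n A xs ys zs\<bar>"
proof -
  have pick: "\<exists>b. 1 \<le> f b" if "2 \<le> f True + f False" for f :: "bool \<Rightarrow> real"
  proof (cases "1 \<le> f True")
    case False
    with that have "1 \<le> f False" by linarith
    then show ?thesis by blast
  qed blast
  define k where "k = n div 2"
  define us where "us = replicate k True"
  define vs where "vs = replicate (n - k) True"
  define zs where "zs = replicate (n + 1) True"
  define ys where "ys = (\<lambda>b. vs @ b # replicate k True)"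
  have len: "length us = k" "length vs = n - k" "length (ys b) = n + 1" "length zs = n + 1" for b
    by (auto simp: us_def vs_def zs_def ys_def k_def)
  have "slice n A us (ys True) zs - slice n A us (ys False) zs = 2 * A us vs []"
  proof -
    have "slice n A us (ys b) zs = (\<Sum>j<n - k. sg (vs ! j) * (A us (take j vs) (take (n - k - j) zs) * sg (zs ! (n - k - j))))
        + sg b * A us vs []" for b
    proof -
      have "n + 1 - k = Suc (n - k)" by (simp add: k_def)
      then show ?thesis by (simp add: slice_def len ys_def nth_append) (simp add: zs_def)
    qed
    then show ?thesis by simp
  qed
  then have "2 \<le> \<bar>slice n A us (ys True) zs\<bar> + \<bar>slice n A us (ys False) zs\<bar>"
    using A[of us vs "[]"] by linarith
  then obtain b where b: "1 \<le> \<bar>slice n A us (ys b) zs\<bar>" using pick[of "\<lambda>b. \<bar>slice n A us (ys b) zs\<bar>"] by blast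
  have "digit_sum n A (us @ [c]) (ys b) zs
      = (\<Sum>i<k. sg (us ! i) * slice n A (take i us) (ys b) zs) + sg c * slice n A us (ys b) zs" for c
    by (simp add: digit_sum_def k_def[symmetric] len nth_append)
  then have "digit_sum n A (us @ [True]) (ys b) zs - digit_sum n A (us @ [False]) (ys b) zs = 2 * slice n A us (ys b) zs"
    by simp
  then have "2 \<le> \<bar>digit_sum n A (us @ [True]) (ys b) zs\<bar> + \<bar>digit_sum n A (us @ [False]) (ys b) zs\<bar>"
    using b by linarith
  then obtain c where "1 \<le> \<bar>digit_sum n A (us @ [c]) (ys b) zs\<bar>"
    using pick[of "\<lambda>c. \<bar>digit_sum n A (us @ [c]) (ys b) zs\<bar>"] by blast
  then show ?thesis
    using len by (intro exI[of _ "us @ [c]"] exI[of _ "ys b"] exI[of _ zs]) (simp add: k_def)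
qed

text \<open>The mean-one identity in the first coordinate, with the sum replaced by its bound
  \<open>B\<close> and every \<open>1 / cosh\<close> by an exponential of a cosine. The parameter
  \<open>\<tau>\<close> allows the frequency \<open>e / \<tau>\<close> to be tuned separately from
  \<open>e\<close>.\<close>

lemma one_le_exp_mult_avg:
  assumes le: "\<And>xs ys zs. length xs = n div 2 + 1 \<Longrightarrow> length ys = n + 1 \<Longrightarrow> length zs = n + 1 \<Longrightarrow> digit_sum n A xs ys zs \<le> B"
    and \<tau>: "0 < \<tau>" "\<tau> \<le> 1 / 2" and e: "0 < e"
  defines "m \<equiv> n div 2 + 1"
  shows "1 \<le> exp (e * B - \<tau>\<^sup>2 / 4 * real m) * avg m (\<lambda>xs. avg (n + 1) (\<lambda>ys. avg (n + 1) (\<lambda>zs.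
    exp (\<tau>\<^sup>2 / 4 * (\<Sum>k<m. cos (e / \<tau> * slice n A (take k xs) ys zs))))))"
proof -
  define E where "E = (\<lambda>xs ys zs. exp (\<tau>\<^sup>2 / 4 * (\<Sum>k<m. cos (e / \<tau> * slice n A (take k xs) ys zs))))"
  have "exp (\<Sum>k<m. e * (sg (xs ! k) * slice n A (take k xs) ys zs)) * (\<Prod>k<m. 1 / cosh (e * slice n A (take k xs) ys zs))
      \<le> exp (e * B - \<tau>\<^sup>2 / 4 * real m) * E xs ys zs"
    if "length xs = m" "length ys = n + 1" "length zs = n + 1" for xs ys zs
  proof -
    have "(\<Prod>k<m. 1 / cosh (e * slice n A (take k xs) ys zs))
      \<le> (\<Prod>k<m. exp (- (\<tau>\<^sup>2 / 4 * (1 - cos (e * slice n A (take k xs) ys zs / \<tau>)))))"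
      by (intro prod_mono conjI inverse_cosh_le \<tau>) simp
    also have "\<dots> = exp (- (\<tau>\<^sup>2 / 4 * real m)) * E xs ys zs"
    proof -
      have "(\<Sum>k<m. - (\<tau>\<^sup>2 / 4 * (1 - cos (e * slice n A (take k xs) ys zs / \<tau>))))
        = - (\<tau>\<^sup>2 / 4 * real m) + \<tau>\<^sup>2 / 4 * (\<Sum>k<m. cos (e / \<tau> * slice n A (take k xs) ys zs))"
        by (simp add: sum_negf sum_subtractf right_diff_distrib sum_distrib_left)
      then show ?thesis by (simp only: E_def exp_add[symmetric] exp_sum[symmetric] finite_lessThan)
    qed
    finally have *: "(\<Prod>k<m. 1 / cosh (e * slice n A (take k xs) ys zs)) \<le> exp (- (\<tau>\<^sup>2 / 4 * real m)) * E xs ys zs" .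
    have "(\<Sum>k<m. e * (sg (xs ! k) * slice n A (take k xs) ys zs)) = e * digit_sum n A xs ys zs"
      unfolding digit_sum_def m_def sum_distrib_left ..
    also have "\<dots> \<le> e * B" using le that e by (simp add: m_def)
    finally have "exp (\<Sum>k<m. e * (sg (xs ! k) * slice n A (take k xs) ys zs)) \<le> exp (e * B)" by simp
    from mult_mono[OF this *]
    have "exp (\<Sum>k<m. e * (sg (xs ! k) * slice n A (take k xs) ys zs)) * (\<Prod>k<m. 1 / cosh (e * slice n A (take k xs) ys zs))
      \<le> exp (e * B) * (exp (- (\<tau>\<^sup>2 / 4 * real m)) * E xs ys zs)"
      by (simp add: prod_nonneg)
    also have "\<dots> = exp (e * B - \<tau>\<^sup>2 / 4 * real m) * E xs ys zs"
      by (simp flip: exp_add mult.assoc)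
    finally show ?thesis .
  qed
  then have "avg (n + 1) (\<lambda>ys. avg (n + 1) (\<lambda>zs. avg m (\<lambda>xs. exp (\<Sum>k<m. e * (sg (xs ! k) * slice n A (take k xs) ys zs))
        * (\<Prod>k<m. 1 / cosh (e * slice n A (take k xs) ys zs)))))
     \<le> avg (n + 1) (\<lambda>ys. avg (n + 1) (\<lambda>zs. avg m (\<lambda>xs. exp (e * B - \<tau>\<^sup>2 / 4 * real m) * E xs ys zs)))"
    by (intro avg_mono) blast
  also have "\<dots> = exp (e * B - \<tau>\<^sup>2 / 4 * real m) * avg (n + 1) (\<lambda>ys. avg (n + 1) (\<lambda>zs. avg m (\<lambda>xs. E xs ys zs)))"
    by (simp only: avg_cmult)
  also have "avg (n + 1) (\<lambda>ys. avg (n + 1) (\<lambda>zs. avg m (\<lambda>xs. E xs ys zs)))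
      = avg (n + 1) (\<lambda>ys. avg m (\<lambda>xs. avg (n + 1) (\<lambda>zs. E xs ys zs)))"
    by (subst avg_swap[of "n + 1" m]) simp
  also have "\<dots> = avg m (\<lambda>xs. avg (n + 1) (\<lambda>ys. avg (n + 1) (\<lambda>zs. E xs ys zs)))"
    by (rule avg_swap)
  finally show ?thesis
    unfolding avg_exp_div_cosh[of m e "\<lambda>us. slice n A us _ _"] avg_const E_def .
qed

text \<open>Here \<open>a = 4 / sqrt n\<close> and \<open>\<kappa>\<close> has order
  \<open>n powr (-3/4)\<close>, so \<open>c\<close> has order \<open>1 / sqrt n\<close>, which
  matches off-diagonal pair sums of size \<open>sqrt n\<close>. All errors are thus absolute
  constants, while the main term is half of the trivial bound \<open>\<kappa> * m\<close>.\<close>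

lemma avg_exp_sum_cos_slice_le:
  assumes A: "\<And>us vs ws. \<bar>A us vs ws\<bar> = 1" and t: "t ^ 8 = real n" "2 \<le> t"
    and xs: "length xs = m" and m: "m = n div 2 + 1"
  shows "avg (n + 1) (\<lambda>ys. avg (n + 1) (\<lambda>zs.
    exp (1 / (64 * t ^ 6) * (\<Sum>k<m. cos (4 / t ^ 4 * slice n A (take k xs) ys zs)))))
    \<le> exp (1 / (64 * t ^ 6) * real m / 2 + (33 + exp 64))"
proof -
  define a where "a = 4 / t ^ 4"
  define \<kappa> where "\<kappa> = 1 / (64 * t ^ 6)"
  have t4: "16 \<le> t ^ 4" using power_mono[OF t(2), of 4] by simp
  have t8: "256 \<le> t ^ 8" using power_mono[OF t(2), of 8] by simp
  then have n: "256 \<le> n" using t by simp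
  have a: "0 \<le> a" "a \<le> 1" using t4 by (simp_all add: a_def divide_le_eq)
  have a2: "a\<^sup>2 = 16 / n" using t(2) by (simp add: a_def power_divide flip: t(1) power_mult)
  have \<kappa>: "0 \<le> \<kappa>" using t(2) by (simp add: \<kappa>_def)
  have mn: "0 < m" "m \<le> n" "n \<le> 2 * m" using n by (auto simp: m)
  interpret sign_system n "\<lambda>k. A (take k xs)" a
    by standard (use A a in auto)
  have walk: "walk k ys zs = slice n A (take k xs) ys zs" if "k < m" "length ys = n + 1" for k ys zs
  proof -
    have "length (take k xs) = k" using that xs by simp
    then have "slice n A (take k xs) ys zs = (\<Sum>j<n + 1 - k. trm k j ys zs)"
      unfolding slice_def using that mn by (intro sum.cong) (auto simp: trm_def coef_def)
    also have "\<dots> = (\<Sum>j<n + 1. trm k j ys zs)"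
      using that mn by (intro sum.mono_neutral_left) (auto simp: trm_def coef_def)
    finally show ?thesis using that by (simp only: walk_def)
  qed
  \<comment> \<open>The factor \<open>exp (- 64)\<close> pays for the growth
    \<open>(1 + 2 * a\<^sup>2) ^ (n + 1)\<close>; \<open>\<mu>\<close> still has order
    \<open>1 / n\<close>.\<close>
  define \<mu> where "\<mu> = a\<^sup>2 * exp (- 64) / 2"
  have \<mu>0: "0 < \<mu>" using n by (simp add: \<mu>_def a2)
  have pow: "(1 + 2 * a\<^sup>2) ^ (n + 1) \<le> exp 64"
  proof -
    have "(1 + 2 * a\<^sup>2) ^ (n + 1) \<le> exp (2 * a\<^sup>2) ^ (n + 1)"
      by (intro power_mono exp_ge_add_one_self) auto
    also have "\<dots> = exp (32 * (n + 1) / n)"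
      by (simp add: a2 exp_of_nat_mult[symmetric] del: power_Suc)
    also have "\<dots> \<le> exp 64" using n by (simp add: field_simps)
    finally show ?thesis .
  qed
  then have "\<mu> * (1 + 2 * a\<^sup>2) ^ (n + 1) \<le> \<mu> * exp 64" using \<mu>0 by (intro mult_left_mono) auto
  also have "\<dots> = a\<^sup>2 / 2" by (simp add: \<mu>_def flip: exp_add)
  finally have \<mu>: "\<mu> * (1 + 2 * a\<^sup>2) ^ (n + 1) \<le> a\<^sup>2 / 2" .
  have "2 * real (n + 1) * (\<mu> * (1 + 2 * a\<^sup>2) ^ (n + 1)) \<le> 2 * real (n + 1) * (a\<^sup>2 / 2)"
    using \<mu> by (intro mult_left_mono) auto
  also have "\<dots> \<le> 32" using n by (simp add: a2 field_simps)
  finally have pb: "phase_bound \<mu> \<le> exp 32" by (simp only: phase_bound_def exp_le_cancel_iff)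
  have \<kappa>a: "\<kappa>\<^sup>2 * a\<^sup>2 * (real n)\<^sup>2 = 1 / (256 * t ^ 4)"
    using t(2) unfolding t(1)[symmetric] \<kappa>_def a_def
    by (simp add: power_divide power_mult_distrib field_simps flip: power_mult power_add)
  define c where "c = 2 * \<kappa>\<^sup>2 * a\<^sup>2 * (real m)\<^sup>2"
  have "c \<le> 2 * \<kappa>\<^sup>2 * a\<^sup>2 * (real n)\<^sup>2"
    unfolding c_def using mn by (intro mult_left_mono power_mono) auto
  also have "\<dots> = 1 / (128 * t ^ 4)" using \<kappa>a by simp
  finally have c: "c \<le> 1 / (128 * t ^ 4)" .
  have "c\<^sup>2 \<le> (1 / (128 * t ^ 4))\<^sup>2" using c by (intro power_mono) (auto simp: c_def)
  also have "\<dots> = 1 / (16384 * n)" by (simp add: power_divide power_mult_distrib flip: t(1) power_mult)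
  also have "\<dots> \<le> 32 / n" using n by (simp add: field_simps)
  finally have "c\<^sup>2 / (4 * \<mu>) \<le> 32 / n / (4 * \<mu>)" using \<mu>0 by (intro divide_right_mono) auto
  also have "\<dots> = exp 64" using n by (simp add: \<mu>_def a2 exp_minus field_simps)
  finally have c2: "c\<^sup>2 / (4 * \<mu>) \<le> exp 64" .
  have "2 * \<kappa>\<^sup>2 * a\<^sup>2 * (real m * real (n + 1)) \<le> 2 * \<kappa>\<^sup>2 * a\<^sup>2 * (real n * (2 * real n))"
    using mn n by (intro mult_left_mono mult_mono) auto
  also have "\<dots> = 4 * (\<kappa>\<^sup>2 * a\<^sup>2 * (real n)\<^sup>2)" by (simp add: power2_eq_square)
  also have "\<dots> \<le> 1" unfolding \<kappa>a using t4 t(2) by (simp add: field_simps)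
  finally have D: "2 * \<kappa>\<^sup>2 * a\<^sup>2 * (real m * real (n + 1)) \<le> 1" .
  \<comment> \<open>Here \<open>k \<le> n div 2\<close> enters: at least \<open>n / 2\<close>
    factors \<open>cos a\<close> remain, enough to push the mean of each cosine down to
    \<open>1 / 2\<close>.\<close>
  have "(\<Sum>k<m. cos a ^ (n + 1 - k)) \<le> (\<Sum>k<m. 1 / 2)"
  proof (rule sum_mono)
    fix k assume "k \<in> {..<m}"
    then have k: "n \<le> 2 * (n + 1 - k)" using m by auto
    have "cos a ^ (n + 1 - k) \<le> exp (- (a\<^sup>2 / 4)) ^ (n + 1 - k)"
      using a cos_a by (intro power_mono cos_le_exp) auto
    also have "\<dots> = exp (- (4 * real (n + 1 - k) / n))"
      by (simp add: a2 exp_of_nat_mult[symmetric] field_simps)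
    also have "\<dots> \<le> exp (- 2)"
    proof -
      have "real n \<le> 2 * real (n + 1 - k)" using k by linarith
      then show ?thesis using n by (simp add: field_simps)
    qed
    also have "\<dots> \<le> 1 / 2"
      using exp_ge_add_one_self[of 2] by (simp add: exp_minus field_simps)
    finally show "cos a ^ (n + 1 - k) \<le> 1 / 2" .
  qed
  then have "\<kappa> * (\<Sum>k<m. cos a ^ (n + 1 - k)) \<le> \<kappa> * (real m / 2)"
    using \<kappa> by (intro mult_left_mono) auto
  then have F: "exp (\<kappa> * (\<Sum>k<m. cos a ^ (n + 1 - k))) \<le> exp (\<kappa> * real m / 2)" by simp
  have P: "1 + exp (2 * \<kappa>\<^sup>2 * a\<^sup>2 * (real m * real (n + 1))) * (exp (c\<^sup>2 / (4 * \<mu>)) * phase_bound \<mu>)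
     \<le> 2 * exp (33 + exp 64)"
  proof -
    have "exp (2 * \<kappa>\<^sup>2 * a\<^sup>2 * (real m * real (n + 1))) * (exp (c\<^sup>2 / (4 * \<mu>)) * phase_bound \<mu>)
      \<le> exp 1 * (exp (exp 64) * exp 32)"
      using D c2 pb by (intro mult_mono) (auto simp: phase_bound_def)
    also have "\<dots> = exp (33 + exp 64)" by (simp flip: exp_add)
    finally show ?thesis using one_le_exp_iff[of "33 + exp (64::real)"] exp_gt_zero[of "64::real"] by linarith
  qed
  have "avg (n + 1) (\<lambda>ys. avg (n + 1) (\<lambda>zs. exp (\<kappa> * (\<Sum>k<m. cos (a * slice n A (take k xs) ys zs)))))
     = avg (n + 1) (\<lambda>ys. avg (n + 1) (\<lambda>zs. exp (\<kappa> * (\<Sum>k<m. cos (a * walk k ys zs)))))"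
    by (intro avg_cong arg_cong[where f = exp] arg_cong2[where f = "(*)"] sum.cong) (auto simp: walk)
  also have "\<dots> \<le> exp (\<kappa> * (\<Sum>k<m. cos a ^ (n + 1 - k))) / 2
      * (1 + exp (2 * \<kappa>\<^sup>2 * a\<^sup>2 * (real m * real (n + 1))) * (exp (c\<^sup>2 / (4 * \<mu>)) * phase_bound \<mu>))"
    unfolding c_def using mn \<mu>0 \<mu> \<kappa> by (intro avg_exp_sum_cos_le) auto
  also have "\<dots> \<le> exp (\<kappa> * real m / 2) / 2 * (2 * exp (33 + exp 64))"
    using F P \<mu>0 by (intro mult_mono divide_right_mono) (auto simp: phase_bound_def)
  also have "\<dots> = exp (\<kappa> * real m / 2 + (33 + exp 64))"
    unfolding exp_add by simp
  finally show ?thesis by (simp only: \<kappa>_def a_def)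
qed

text \<open>If the sum stayed below \<open>t ^ 9 / 512\<close>, then \<open>e * B\<close> would be
  at most \<open>t\<^sup>2 / 512\<close>, against a gain of at least \<open>t\<^sup>2 / 256\<close>
  from the cosines and a constant error below \<open>t\<^sup>2 / 512\<close>; the mean-one identity
  would fail.\<close>

lemma digit_sum_large:
  assumes A: "\<And>us vs ws. \<bar>A us vs ws\<bar> = 1" and t: "t ^ 8 = real n" "2 \<le> t" "512 * (33 + exp 64) < t\<^sup>2"
  shows "\<exists>xs ys zs. length xs = n div 2 + 1 \<and> length ys = n + 1 \<and> length zs = n + 1
     \<and> t ^ 9 / 512 \<le> digit_sum n A xs ys zs"
proof (rule ccontr)
  assume neg: "\<not> ?thesis"
  define m where "m = n div 2 + 1"
  define K :: real where "K = 33 + exp 64"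
  define \<tau> where "\<tau> = 1 / (4 * t ^ 3)"
  define e where "e = 1 / t ^ 7"
  have "2 \<le> 4 * t ^ 3" using power_mono[OF t(2), of 3] by simp
  then have \<tau>: "0 < \<tau>" "\<tau> \<le> 1 / 2" and e: "0 < e"
    using t(2) by (auto simp: \<tau>_def e_def field_simps)
  have \<tau>2: "\<tau>\<^sup>2 / 4 = 1 / (64 * t ^ 6)"
    by (simp add: \<tau>_def power_divide power_mult_distrib flip: power_mult)
  have e\<tau>: "e / \<tau> = 4 / t ^ 4"
    using t(2) by (simp add: \<tau>_def e_def field_simps flip: power_add)
  have "digit_sum n A xs ys zs \<le> t ^ 9 / 512"
    if "length xs = n div 2 + 1" "length ys = n + 1" "length zs = n + 1" for xs ys zs
    using neg that by (meson nle_le)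
  from one_le_exp_mult_avg[OF this \<tau> e]
  have "1 \<le> exp (e * (t ^ 9 / 512) - \<tau>\<^sup>2 / 4 * real m) * avg m (\<lambda>xs. avg (n + 1) (\<lambda>ys. avg (n + 1) (\<lambda>zs.
    exp (1 / (64 * t ^ 6) * (\<Sum>k<m. cos (4 / t ^ 4 * slice n A (take k xs) ys zs))))))"
    unfolding m_def[symmetric] \<tau>2 e\<tau> .
  also have "\<dots> \<le> exp (e * (t ^ 9 / 512) - \<tau>\<^sup>2 / 4 * real m) * avg m (\<lambda>xs. exp (1 / (64 * t ^ 6) * real m / 2 + K))"
    unfolding K_def using A t m_def by (intro mult_left_mono avg_mono avg_exp_sum_cos_slice_le) auto
  also have "\<dots> = exp (e * (t ^ 9 / 512) - \<tau>\<^sup>2 / 4 * real m / 2 + K)"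
    unfolding avg_const exp_add[symmetric] \<tau>2 by simp
  finally have "0 \<le> e * (t ^ 9 / 512) - \<tau>\<^sup>2 / 4 * real m / 2 + K" by simp
  moreover have "e * (t ^ 9 / 512) = t\<^sup>2 / 512"
    using t(2) by (simp add: e_def field_simps flip: power_add)
  moreover have "t\<^sup>2 / 256 \<le> \<tau>\<^sup>2 / 4 * real m / 2"
  proof -
    have "t\<^sup>2 / 256 = 1 / (64 * t ^ 6) * (t ^ 8 / 2) / 2"
      using t(2) by (simp add: field_simps flip: power_add)
    also have "\<dots> \<le> \<tau>\<^sup>2 / 4 * real m / 2"
      unfolding \<tau>2 t(1) using t(2) by (intro divide_right_mono mult_left_mono) (auto simp: m_def)
    finally show ?thesis .
  qed
  moreover have "512 * K < t\<^sup>2" using t(3) by (simp only: K_def)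
  ultimately show False by argo
qed

lemma digit_sum_lower_bound:
  "\<exists>c>0. \<forall>n A. n \<ge> 1 \<longrightarrow> (\<forall>us vs ws. \<bar>A us vs ws\<bar> = 1) \<longrightarrow>
    (\<exists>xs ys zs. length xs = n div 2 + 1 \<and> length ys = n + 1 \<and> length zs = n + 1
       \<and> c * real n powr (9 / 8) \<le> \<bar>digit_sum n A xs ys zs\<bar>)"
proof -
  define K :: real where "K = 33 + exp 64"
  define T where "T = sqrt (512 * K) + 2"
  have K: "0 < K" by (simp add: K_def add_pos_pos)
  then have T: "2 \<le> T" by (simp add: T_def)
  \<comment> \<open>The first entry serves \<open>t > T\<close>. The second gives
    \<open>c * t ^ 9 \<le> 1\<close> for \<open>t \<le> T\<close>, where
    \<open>digit_sum_ge_1\<close> suffices.\<close>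
  define c where "c = min (1 / 512) (1 / T ^ 9)"
  have "\<exists>xs ys zs. length xs = n div 2 + 1 \<and> length ys = n + 1 \<and> length zs = n + 1
       \<and> c * real n powr (9 / 8) \<le> \<bar>digit_sum n A xs ys zs\<bar>"
    if n: "n \<ge> 1" and A: "\<forall>us vs ws. \<bar>A us vs ws\<bar> = 1" for n A
  proof -
    define t where "t = real n powr (1 / 8)"
    have t: "0 < t" "t ^ 8 = real n" "real n powr (9 / 8) = t ^ 9"
      using n by (auto simp: t_def powr_powr simp flip: powr_realpow)
    show ?thesis
    proof (cases "T < t")
      case True
      have "512 * K = (sqrt (512 * K))\<^sup>2" using K by simp
      also have "\<dots> < t\<^sup>2" using True K by (intro power_strict_mono) (auto simp: T_def)
      finally obtain xs ys zs where *: "length xs = n div 2 + 1" "length ys = n + 1" "length zs = n + 1"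
        "t ^ 9 / 512 \<le> digit_sum n A xs ys zs"
        using digit_sum_large[of A t n] A t True T by (auto simp: K_def)
      have "c * t ^ 9 \<le> 1 / 512 * t ^ 9" using t by (intro mult_right_mono) (auto simp: c_def)
      with *(4) have "c * real n powr (9 / 8) \<le> \<bar>digit_sum n A xs ys zs\<bar>"
        unfolding t(3) by linarith
      with *(1-3) show ?thesis by blast
    next
      case False
      have "c * t ^ 9 \<le> 1 / T ^ 9 * T ^ 9"
        using t T False by (intro mult_mono power_mono) (auto simp: c_def)
      also have "\<dots> = 1" using T by simp
      finally show ?thesis using digit_sum_ge_1[of A n] A t(3) by (metis order_trans)
    qed
  qed
  moreover have "0 < c" using T by (simp add: c_def)
  ultimately show ?thesis by blast
qed

subsection \<open>Dyadic rectangles and digits\<close>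

text \<open>Most significant digit first, so that prefixes of a string correspond to the dyadic
  ancestors of its cell.\<close>

definition index :: "bool list \<Rightarrow> nat" where
  "index bs = fold (\<lambda>b i. 2 * i + of_bool b) bs 0"

lemma index_snoc: "index (bs @ [b]) = 2 * index bs + of_bool b"
  by (simp add: index_def)

lemma index_less: "index bs < 2 ^ length bs"
proof (induction bs rule: rev_induct)
  case Nil
  then show ?case by (simp add: index_def)
next
  case (snoc b bs)
  then show ?case by (auto simp: index_snoc)
qed

definition cell :: "bool list \<Rightarrow> real set" where
  "cell bs = {real (index bs) / 2 ^ length bs ..< (real (index bs) + 1) / 2 ^ length bs}"

lemma cell_dyadic: "cell bs \<in> dyadic_intervals"
  unfolding dyadic_intervals_def cell_def
  by (intro CollectI exI[of _ "int (index bs)"] exI[of _ "- int (length bs)"])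
     (simp add: power_int_minus divide_inverse)

lemma measure_cell: "measure lborel (cell bs) = 1 / 2 ^ length bs"
  by (simp add: cell_def divide_right_mono add_divide_distrib)

lemma cell_subset: "cell bs \<subseteq> {0..1}"
proof -
  have "index bs + 1 \<le> 2 ^ length bs" using index_less[of bs] by simp
  then have "real (index bs + 1) \<le> real (2 ^ length bs)" by (simp only: of_nat_le_iff)
  then have "real (index bs) + 1 \<le> 2 ^ length bs" by simp
  then have 1: "(real (index bs) + 1) / 2 ^ length bs \<le> 1" by simp
  have 0: "0 \<le> real (index bs) / 2 ^ length bs" by simp
  show ?thesis
  proof
    fix x assume "x \<in> cell bs"
    then have "real (index bs) / 2 ^ length bs \<le> x" "x < (real (index bs) + 1) / 2 ^ length bs"
      by (simp_all add: cell_def)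
    with 0 1 have "0 \<le> x" "x \<le> 1" by linarith+
    then show "x \<in> {0..1}" by simp
  qed
qed

text \<open>Appending a digit selects a half of the cell, \<open>True\<close> being the right one,
  where the Haar function is 1 as is \<open>sg True\<close>.\<close>

lemma cell_snoc:
  assumes "x \<in> cell (bs @ [b])"
  shows "x \<in> cell bs" "haar (cell bs) x = sg b"
proof -
  define p :: real where "p = 2 ^ length bs"
  have p: "0 < p" by (simp add: p_def)
  define i where "i = real (index bs)"
  have x: "(2 * i + of_bool b) / (2 * p) \<le> x" "x < (2 * i + of_bool b + 1) / (2 * p)"
    using assms by (auto simp: cell_def index_snoc p_def i_def)
  have c: "cell bs = {i / p..<(i + 1) / p}" by (simp add: cell_def p_def i_def)
  have lt: "i / p < (i + 1) / p" using p by (simp add: divide_strict_right_mono)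
  have h: "haar (cell bs) x = - indicator {i / p..<(i + 1/2) / p} x + indicator {(i + 1/2) / p..<(i + 1) / p} x"
  proof -
    have "(i / p + (i + 1) / p) / 2 = (i + 1/2) / p" using p by (simp add: field_simps)
    then show ?thesis by (simp only: c haar_atLeastLessThan[OF lt])
  qed
  show "x \<in> cell bs" using x p unfolding c by (cases b) (auto simp: field_simps)
  show "haar (cell bs) x = sg b"
    unfolding h using x p by (cases b) (auto simp: field_simps indicator_def)
qed

lemma cell_take:
  assumes "x \<in> cell bs"
  shows "x \<in> cell (take k bs)"
  using assms
proof (induction bs rule: rev_induct)
  case (snoc b bs)
  then show ?case using cell_snoc(1)[of x bs b] by (cases "k \<le> length bs") auto
qed simp

lemma haar_cell_take:
  assumes "x \<in> cell bs" "k < length bs"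
  shows "haar (cell (take k bs)) x = sg (bs ! k)"
proof (rule cell_snoc)
  show "x \<in> cell (take k bs @ [bs ! k])"
    using cell_take[OF assms(1), of "Suc k"] assms(2) by (simp add: take_Suc_conv_app_nth)
qed

text \<open>The left endpoint is recovered from the length \<open>p\<close> and any point
  \<open>x\<close> of the interval as \<open>\<lfloor>x / p\<rfloor> * p\<close>.\<close>

lemma dyadic_interval_eqI:
  assumes "I \<in> dyadic_intervals" "J \<in> dyadic_intervals" "measure lborel I = measure lborel J" "x \<in> I" "x \<in> J"
  shows "I = J"
proof -
  have *: "\<exists>p>0. measure lborel K = p \<and> K = {of_int \<lfloor>x / p\<rfloor> * p..<(of_int \<lfloor>x / p\<rfloor> + 1) * p}"
    if K_dyadic: "K \<in> dyadic_intervals" and "x \<in> K" for K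
  proof -
    obtain j k :: int where K: "K = {of_int j * 2 powi k ..< (of_int j + 1) * 2 powi k}"
      using K_dyadic unfolding dyadic_intervals_def by blast
    define p :: real where "p = 2 powi k"
    have p: "0 < p" by (simp add: p_def)
    have K: "K = {of_int j * p..<(of_int j + 1) * p}" by (simp add: K p_def)
    have "\<lfloor>x / p\<rfloor> = j"
      using \<open>x \<in> K\<close> p by (intro floor_unique) (auto simp: K field_simps)
    moreover have "measure lborel K = p" using p by (simp add: K algebra_simps)
    ultimately show ?thesis using p K by blast
  qed
  show ?thesis using *[OF assms(1,4)] *[OF assms(2,5)] assms(3) by auto
qed

lemma measure_dyadic_interval:
  assumes "I \<in> dyadic_intervals" "I \<subseteq> {0..1}"
  obtains k :: nat where "measure lborel I = 1 / 2 ^ k"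
proof -
  obtain j k :: int where I: "I = {of_int j * 2 powi k ..< (of_int j + 1) * 2 powi k}"
    using assms unfolding dyadic_intervals_def by blast
  define p :: real where "p = 2 powi k"
  have p: "0 < p" by (simp add: p_def)
  have I: "I = {of_int j * p..<(of_int j + 1) * p}" by (simp add: I p_def)
  have lt: "of_int j * p < (of_int j + 1) * p" using p by (simp add: algebra_simps)
  have m: "measure lborel I = p" using lt by (simp add: I algebra_simps)
  have "{of_int j * p <..< (of_int j + 1) * p} \<subseteq> {0..1}" using assms(2) by (auto simp: I)
  then have "0 \<le> of_int j * p" "(of_int j + 1) * p \<le> 1"
    using lt by (simp_all add: greaterThanLessThan_subseteq_atLeastAtMost_iff)
  then have "p \<le> 1" by (simp add: algebra_simps)
  then have "k \<le> 0" using power_int_strict_increasing[of 0 k "2::real"] by (force simp: p_def not_le)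
  then have "k = - int (nat (- k))" by simp
  then have "p = 2 powi (- int (nat (- k)))" by (simp only: p_def)
  then have "p = 1 / 2 ^ nat (- k)"
    by (simp only: power_int_minus power_int_of_nat inverse_eq_divide)
  with m that show thesis by blast
qed

lemma haar_outside: "x \<notin> I \<Longrightarrow> haar I x = 0"
  by (simp add: haar_def left_half_def right_half_def)

text \<open>The volume forces the third scale to be \<open>n - k - j\<close>, so two scales
  parametrise the admissible rectangles over a given cell.\<close>

definition rect :: "nat \<Rightarrow> bool list \<Rightarrow> bool list \<Rightarrow> bool list \<Rightarrow> nat \<times> nat \<Rightarrow> rect3" where
  "rect n xs ys zs = (\<lambda>(k, j). (cell (take k xs), cell (take j ys), cell (take (n - k - j) zs)))"

lemma rect_admissible:
  assumes "length xs = n div 2 + 1" "length ys = n + 1" "length zs = n + 1"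
    and "k < n div 2 + 1" "j < n + 1 - k"
  shows "rect n xs ys zs (k, j) \<in> admissible_rectangles n"
proof -
  have d: "rect n xs ys zs (k, j) \<in> dyadic_rectangles"
    by (simp add: rect_def dyadic_rectangles_def cell_dyadic)
  have "box_of (rect n xs ys zs (k, j)) \<subseteq> unit_cube"
    unfolding rect_def box_of_def unit_cube_def using cell_subset by auto
  moreover have "measure lborel (box_of (rect n xs ys zs (k, j))) = 2 powr (- real n)"
  proof -
    have "k + (j + (n - k - j)) = n" using assms by linarith
    then have "(2::real) ^ n = 2 ^ k * (2 ^ j * 2 ^ (n - k - j))" by (metis power_add)
    then show ?thesis using d assms
      by (simp add: rect_def measure_box_of measure_cell powr_minus powr_realpow divide_inverse)
  qed
  moreover have "2 powr (- real n / 2) \<le> measure lborel (fst (rect n xs ys zs (k, j)))"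
  proof -
    have "real k \<le> real n / 2" using assms by linarith
    then have "2 powr (- real n / 2) \<le> 2 powr (- real k)" by (intro powr_mono) auto
    also have "2 powr (- real k) = (1::real) / 2 ^ k"
      by (simp add: powr_minus powr_realpow divide_inverse)
    also have "\<dots> = measure lborel (fst (rect n xs ys zs (k, j)))"
      using assms by (simp add: rect_def measure_cell)
    finally show ?thesis .
  qed
  ultimately show ?thesis using d by (simp add: admissible_rectangles_def)
qed

text \<open>The side lengths are powers of \<open>1 / 2\<close> with exponents summing to
  \<open>n\<close>, the first at most \<open>n / 2\<close>. Each side shares the given point with
  the prefix cell of equal length, hence equals it.\<close>

lemma admissible_rectangle_at:
  assumes len: "length xs = n div 2 + 1" "length ys = n + 1" "length zs = n + 1"
    and x: "x \<in> cell xs" "y \<in> cell ys" "z \<in> cell zs"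
    and R: "R \<in> admissible_rectangles n" "(x, y, z) \<in> box_of R"
  obtains k j where "k < n div 2 + 1" "j < n + 1 - k" "R = rect n xs ys zs (k, j)"
proof -
  obtain R1 R2 R3 where R': "R = (R1, R2, R3)" by (cases R)
  have d: "R1 \<in> dyadic_intervals" "R2 \<in> dyadic_intervals" "R3 \<in> dyadic_intervals"
    and ms: "measure lborel (box_of R) = 2 powr (- real n)" "measure lborel R1 \<ge> 2 powr (- real n / 2)"
    using R by (auto simp: R' admissible_rectangles_def dyadic_rectangles_def)
  have x': "x \<in> R1" "y \<in> R2" "z \<in> R3" using R(2) by (auto simp: R' box_of_def)
  have s: "R1 \<subseteq> {0..1}" "R2 \<subseteq> {0..1}" "R3 \<subseteq> {0..1}"
    using R(1) x' by (auto simp: R' admissible_rectangles_def box_of_def unit_cube_def times_subset_iff)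
  obtain k where k: "measure lborel R1 = 1 / 2 ^ k" by (rule measure_dyadic_interval[OF d(1) s(1)])
  obtain j where j: "measure lborel R2 = 1 / 2 ^ j" by (rule measure_dyadic_interval[OF d(2) s(2)])
  obtain l where l: "measure lborel R3 = 1 / 2 ^ l" by (rule measure_dyadic_interval[OF d(3) s(3)])
  have "(1::real) / 2 ^ k * (1 / 2 ^ j * (1 / 2 ^ l)) = 2 powr (- real n)"
    using ms(1) d k j l by (simp add: R' dyadic_rectangles_def measure_box_of)
  then have "(2::real) ^ (k + (j + l)) = 2 ^ n"
    by (simp add: powr_minus powr_realpow power_add field_simps)
  then have n: "k + (j + l) = n" by simp
  have "(1::real) / 2 ^ k = 2 powr (- real k)"
    by (simp add: powr_minus powr_realpow divide_inverse)
  then have "2 powr (- real n / 2) \<le> 2 powr (- real k)"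
    using ms(2) k by (simp only:)
  then have k2: "2 * k \<le> n" by simp
  have "R1 = cell (take k xs)"
    using k2 by (intro dyadic_interval_eqI[OF d(1) cell_dyadic _ x'(1) cell_take[OF x(1)]]) (auto simp: k measure_cell len)
  moreover have "R2 = cell (take j ys)"
    using n by (intro dyadic_interval_eqI[OF d(2) cell_dyadic _ x'(2) cell_take[OF x(2)]]) (auto simp: j measure_cell len)
  moreover have "R3 = cell (take (n - k - j) zs)"
    using n by (intro dyadic_interval_eqI[OF d(3) cell_dyadic _ x'(3) cell_take[OF x(3)]]) (auto simp: l measure_cell len)
  ultimately show thesis using that[of k j] k2 n by (auto simp: R' rect_def)
qed

text \<open>Only rectangles through the point contribute, one for each pair \<open>(k, j)\<close>,
  and their Haar values are products of three signs. In particular the sum is constant on the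
  product of the three cells.\<close>

lemma haar_sum_eq_digit_sum:
  assumes len: "length xs = n div 2 + 1" "length ys = n + 1" "length zs = n + 1"
    and x: "x \<in> cell xs" "y \<in> cell ys" "z \<in> cell zs"
    and A: "\<And>us vs ws. (cell us, cell vs, cell ws) \<in> admissible_rectangles n \<Longrightarrow> A us vs ws = a (cell us, cell vs, cell ws)"
  shows "(\<Sum>R\<in>admissible_rectangles n. a R * haar3 R (x, y, z)) = digit_sum n A xs ys zs"
proof -
  let ?P = "SIGMA k:{..<n div 2 + 1}. {..<n + 1 - k}"
  let ?r = "rect n xs ys zs"
  have inj: "inj_on ?r ?P"
  proof (rule inj_onI)
    fix p q assume "p \<in> ?P" "q \<in> ?P" and eq: "?r p = ?r q"
    then obtain k j k' j' where pq: "p = (k, j)" "q = (k', j')"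
      and b: "k \<le> length xs" "k' \<le> length xs" "j \<le> length ys" "j' \<le> length ys"
      using len by (cases p; cases q) auto
    have "measure lborel (cell (take k xs)) = measure lborel (cell (take k' xs))"
      "measure lborel (cell (take j ys)) = measure lborel (cell (take j' ys))"
      using eq by (auto simp: pq rect_def)
    then show "p = q" using b by (simp add: pq measure_cell)
  qed
  have "(\<Sum>R\<in>admissible_rectangles n. a R * haar3 R (x, y, z)) = (\<Sum>R\<in>?r ` ?P. a R * haar3 R (x, y, z))"
  proof (rule sum.mono_neutral_right[OF finite_admissible_rectangles])
    show "?r ` ?P \<subseteq> admissible_rectangles n" using rect_admissible[OF len] by auto
    show "\<forall>R\<in>admissible_rectangles n - ?r ` ?P. a R * haar3 R (x, y, z) = 0"
    proof
      fix R assume R: "R \<in> admissible_rectangles n - ?r ` ?P"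
      have "(x, y, z) \<notin> box_of R"
      proof
        assume "(x, y, z) \<in> box_of R"
        with R obtain k j where "k < n div 2 + 1" "j < n + 1 - k" "R = ?r (k, j)"
          using admissible_rectangle_at[OF len x, of R] by blast
        then have "R \<in> ?r ` ?P" by (intro image_eqI[of _ _ "(k, j)"]) auto
        with R show False by blast
      qed
      then show "a R * haar3 R (x, y, z) = 0"
        by (cases R) (auto simp: haar3_def box_of_def haar_outside)
    qed
  qed
  also have "\<dots> = (\<Sum>p\<in>?P. a (?r p) * haar3 (?r p) (x, y, z))"
    unfolding sum.reindex[OF inj] comp_def ..
  also have "\<dots> = (\<Sum>k<n div 2 + 1. \<Sum>j<n + 1 - k. a (?r (k, j)) * haar3 (?r (k, j)) (x, y, z))"
    by (subst sum.Sigma) (auto simp: case_prod_unfold)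
  also have "\<dots> = digit_sum n A xs ys zs"
    unfolding digit_sum_def slice_def sum_distrib_left
  proof (intro sum.cong)
    fix k j assume "k \<in> {..<n div 2 + 1}" "j \<in> {..<n + 1 - length (take k xs)}"
    then have k: "k < n div 2 + 1" "j < n + 1 - k" using len by auto
    have "A (take k xs) (take j ys) (take (n - k - j) zs) = a (?r (k, j))"
      using rect_admissible[OF len k] A by (simp add: rect_def)
    moreover have "haar3 (?r (k, j)) (x, y, z) = sg (xs ! k) * sg (ys ! j) * sg (zs ! (n - k - j))"
      using k len haar_cell_take[OF x(1), of k] haar_cell_take[OF x(2), of j] haar_cell_take[OF x(3), of "n - k - j"]
      by (simp add: rect_def haar3_def)
    ultimately show "a (?r (k, j)) * haar3 (?r (k, j)) (x, y, z)
      = sg (xs ! k) * (sg (ys ! j) * (A (take k xs) (take j ys) (take (n - length (take k xs) - j) zs) * sg (zs ! (n - length (take k xs) - j))))"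
      using k len by simp
  next
    fix k assume "k \<in> {..<n div 2 + 1}"
    then have "length (take k xs) = k" using len(1) by simp
    then show "{..<n + 1 - k} = {..<n + 1 - length (take k xs)}" by (simp only:)
  qed (rule refl)
  finally show ?thesis .
qed

section \<open>From a single cell to the essential supremum\<close>

lemma Linf_norm_on_ge:
  fixes f :: "'a::euclidean_space \<Rightarrow> real"
  assumes f: "(\<lambda>x. ereal \<bar>f x\<bar>) \<in> borel_measurable (lebesgue_on S)" and S: "S \<in> sets lebesgue"
    and Q: "Q \<in> sets borel" "Q \<subseteq> S" "measure lborel Q > 0" and le: "\<And>x. x \<in> Q \<Longrightarrow> B \<le> \<bar>f x\<bar>"
  shows "ereal B \<le> Linf_norm_on S f"
proof (rule ccontr)
  let ?M = "lebesgue_on S"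
  let ?e = "esssup ?M (\<lambda>x. ereal \<bar>f x\<bar>)"
  assume "\<not> ?thesis"
  then have less: "?e < ereal B" by (simp add: Linf_norm_on_def)
  \<comment> \<open>The function exceeds its essential supremum only on a null set, which would
    contain \<open>Q\<close>.\<close>
  let ?X = "{x \<in> space ?M. ereal \<bar>f x\<bar> > ?e}"
  have "Q \<subseteq> ?X" using Q less le by (auto intro: less_le_trans)
  moreover have "?X \<in> sets ?M" using f by measurable
  ultimately have "emeasure ?M Q \<le> emeasure ?M ?X" by (rule emeasure_mono)
  also have "\<dots> = 0" by (rule esssup_zero_measure)
  finally have "emeasure lebesgue Q = 0"
    using Q S by (simp add: emeasure_restrict_space)
  then have "emeasure lborel Q = 0" using Q by (simp add: emeasure_completion)
  then show False using Q by (simp add: measure_def)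
qed

theorem theorem4p1:
  "\<exists>c>0. \<forall>n\<ge>1. \<forall>a :: rect3 \<Rightarrow> real.
     (\<forall>R\<in>admissible_rectangles n. a R \<in> {1, -1}) \<longrightarrow>
     Linf_norm_on unit_cube (\<lambda>x. \<Sum>R\<in>admissible_rectangles n. a R * haar3 R x)
       \<ge> ereal (c * real n powr (9 / 8))"
proof -
  obtain c where c: "0 < c" and main: "\<And>n A. n \<ge> 1 \<Longrightarrow> (\<And>us vs ws. \<bar>A us vs ws\<bar> = 1) \<Longrightarrow>
    \<exists>xs ys zs. length xs = n div 2 + 1 \<and> length ys = n + 1 \<and> length zs = n + 1
       \<and> c * real n powr (9 / 8) \<le> \<bar>digit_sum n A xs ys zs\<bar>"
    using digit_sum_lower_bound by metis
  have "ereal (c * real n powr (9 / 8)) \<le> Linf_norm_on unit_cube (\<lambda>x. \<Sum>R\<in>admissible_rectangles n. a R * haar3 R x)"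
    if n: "n \<ge> 1" and a: "\<forall>R\<in>admissible_rectangles n. a R \<in> {1, -1}" for n and a :: "rect3 \<Rightarrow> real"
  proof -
    \<comment> \<open>The digit bound asks for signs at all triples of strings, whereas
      \<open>a\<close> is constrained only on admissible rectangles; the value 1 fills in the
      others.\<close>
    define A where "A = (\<lambda>us vs ws. if a (cell us, cell vs, cell ws) \<in> {1, -1} then a (cell us, cell vs, cell ws) else 1)"
    have "\<bar>A us vs ws\<bar> = 1" for us vs ws by (auto simp: A_def)
    from main[OF n, of A, OF this] obtain xs ys zs where len: "length xs = n div 2 + 1" "length ys = n + 1" "length zs = n + 1"
      and le: "c * real n powr (9 / 8) \<le> \<bar>digit_sum n A xs ys zs\<bar>"
      by blast
    let ?R = "(cell xs, cell ys, cell zs)"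
    have R: "?R \<in> dyadic_rectangles" by (simp add: dyadic_rectangles_def cell_dyadic)
    show ?thesis
    proof (rule Linf_norm_on_ge[OF haar_sum_measurable, where Q = "box_of ?R"])
      show "unit_cube \<in> sets lebesgue"
        unfolding unit_cube_def by (intro sets_completionI_sets) (simp add: borel_closed closed_Times)
      show "box_of ?R \<in> sets borel"
        unfolding box_of_def by (simp add: cell_def pair_measureI flip: borel_prod)
      show "box_of ?R \<subseteq> unit_cube"
        unfolding box_of_def unit_cube_def using cell_subset by auto
      show "0 < measure lborel (box_of ?R)"
        using R by (simp add: measure_box_of measure_cell)
    next
      fix p assume "p \<in> box_of ?R"
      then obtain x y z where p: "p = (x, y, z)" "x \<in> cell xs" "y \<in> cell ys" "z \<in> cell zs"
        by (auto simp: box_of_def)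
      have "(\<Sum>R\<in>admissible_rectangles n. a R * haar3 R p) = digit_sum n A xs ys zs"
        unfolding p(1) using a by (intro haar_sum_eq_digit_sum len p) (auto simp: A_def)
      with le show "c * real n powr (9 / 8) \<le> \<bar>\<Sum>R\<in>admissible_rectangles n. a R * haar3 R p\<bar>" by simp
    qed
  qed
  with c show ?thesis by blast
qed

end
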